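(* Let $A=(a_{ij})\in\Sigma_{n\times r}(\mathbb{R}_{\geq0})$ with columns $C_1,\dots,C_r$. For $j\in[r]$ let $\boldsymbol\mu_j\in\{0,1\}^n$ be the vector whose $i$-th coordinate is $0$ if and only if $a_{ij}=0$, and for nonempty $J\subset[r]$ let $\boldsymbol\mu_J\in\{0,1\}^n$ be the unique vector with $\mathrm{Supp}(\boldsymbol\mu_J)=\bigcup_{j\in J}\mathrm{Supp}(\boldsymbol\mu_j)$. Then the possible singularities of the meromorphic extension of the Shintani zeta function $\zeta_A$ are located on the hyperplanes $$\langle\boldsymbol\mu_J,\boldsymbol s\rangle=|J|-l,\qquad \emptyset\neq J\subset[r],\ l\in\mathbb{Z}_{\geq0}.$$ If moreover $\boldsymbol\mu_J$ is a vector of the canonical basis of $\mathbb{R}^n$, then $l$ only takes values in the set $\{1,2,\dots,|J|-1\}$.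
   Context: $\Sigma_{n\times r}(\mathbb{R}_{\geq0})$ is the set of $n\times r$ real matrices with non-negative entries having at least one positive entry in each row and in each column. The Shintani zeta function is $\zeta_A(\boldsymbol s)=\sum_{m_1,\dots,m_r\geq1}\prod_{i=1}^n(a_{i1}m_1+\dots+a_{ir}m_r)^{-s_i}$, absolutely convergent for $\Re(s_i)$ large and known to extend meromorphically to $\mathbb{C}^n$. For $\boldsymbol\mu\in\{0,1\}^n$, $\mathrm{Supp}(\boldsymbol\mu)=\{i\in[n]:\mu_i\neq0\}$.
   Formalization: When μ_J is a canonical basis vector, the range of l is corrected to {0,1,…,|J|-1}; the printed range {1,…,|J|-1} fails for n=r=1, A=(1), where ζ_A is the Riemann zeta function with a pole at s=1=|J|-0. *)

theory Defs
  imports "HOL-Analysis.Analysis"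
begin

definition Sigma_nonneg :: "(real ^ 'r ^ 'n) set" where
  "Sigma_nonneg = {A. (\<forall>i j. A $ i $ j \<ge> 0) \<and> (\<forall>i. \<exists>j. A $ i $ j > 0) \<and> (\<forall>j. \<exists>i. A $ i $ j > 0)}"

definition shintani_term :: "real ^ 'r ^ 'n \<Rightarrow> complex ^ 'n \<Rightarrow> nat ^ 'r \<Rightarrow> complex" where
  "shintani_term A s m =
     (\<Prod>i\<in>UNIV. complex_of_real (\<Sum>j\<in>UNIV. A $ i $ j * real (m $ j)) powr (- (s $ i)))"

definition pos_tuples :: "(nat ^ 'r) set" where
  "pos_tuples = {m. \<forall>j. m $ j \<ge> 1}"

definition shintani_zeta :: "real ^ 'r ^ 'n \<Rightarrow> complex ^ 'n \<Rightarrow> complex" where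
  "shintani_zeta A s = (\<Sum>\<^sub>\<infinity>m\<in>pos_tuples. shintani_term A s m)"

text \<open>Holomorphy in several variables: Frechet differentiability with complex-linear derivative,
  on an open set.\<close>

definition holomorphic_Cn_on :: "(complex ^ 'n \<Rightarrow> complex) \<Rightarrow> (complex ^ 'n) set \<Rightarrow> bool" where
  "holomorphic_Cn_on f U \<longleftrightarrow> open U \<and>
     (\<forall>z\<in>U. \<exists>f'. (f has_derivative f') (at z) \<and> (\<forall>c v. f' (c *s v) = c * f' v))"

text \<open>A meromorphic function is represented by a total function whose values on a thin set (locally
  contained in the zero set of a holomorphic function that does not vanish identically) are
  irrelevant: near every point it is a quotient of holomorphic functions wherever the denominator
  is nonzero.\<close>

definition meromorphic_Cn :: "(complex ^ 'n \<Rightarrow> complex) \<Rightarrow> bool" where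
  "meromorphic_Cn F \<longleftrightarrow>
     (\<forall>p. \<exists>U g h. p \<in> U \<and> connected U \<and> holomorphic_Cn_on g U \<and> holomorphic_Cn_on h U \<and>
        (\<exists>z\<in>U. h z \<noteq> 0) \<and> (\<forall>z\<in>U. h z \<noteq> 0 \<longrightarrow> F z = g z / h z))"

text \<open>Accordingly, a point is regular if near it the function agrees off a thin set with a
  holomorphic function. The singularities, i.e. all other points, comprise the poles and the points
  of indeterminacy.\<close>

definition regular_Cn_at :: "(complex ^ 'n \<Rightarrow> complex) \<Rightarrow> complex ^ 'n \<Rightarrow> bool" where
  "regular_Cn_at F p \<longleftrightarrow>
     (\<exists>U g h. p \<in> U \<and> connected U \<and> holomorphic_Cn_on g U \<and> holomorphic_Cn_on h U \<and>
        (\<exists>z\<in>U. h z \<noteq> 0) \<and> (\<forall>z\<in>U. h z \<noteq> 0 \<longrightarrow> F z = g z))"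

definition singularities_Cn :: "(complex ^ 'n \<Rightarrow> complex) \<Rightarrow> (complex ^ 'n) set" where
  "singularities_Cn F = {p. \<not> regular_Cn_at F p}"

definition shintani_meromorphic_extension ::
    "real ^ 'r ^ 'n \<Rightarrow> (complex ^ 'n \<Rightarrow> complex) \<Rightarrow> bool" where
  "shintani_meromorphic_extension A F \<longleftrightarrow> meromorphic_Cn F \<and>
     (\<exists>\<sigma>::real. \<forall>s. (\<forall>i. Re (s $ i) > \<sigma>) \<longrightarrow>
        (\<lambda>m. norm (shintani_term A s m)) summable_on pos_tuples \<and> F s = shintani_zeta A s)"

definition Supp :: "real ^ 'n \<Rightarrow> 'n set" where
  "Supp \<mu> = {i. \<mu> $ i \<noteq> 0}"

definition mu_col :: "real ^ 'r ^ 'n \<Rightarrow> 'r \<Rightarrow> real ^ 'n" where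
  "mu_col A j = (\<chi> i. if A $ i $ j = 0 then 0 else 1)"

definition mu_set :: "real ^ 'r ^ 'n \<Rightarrow> 'r set \<Rightarrow> real ^ 'n" where
  "mu_set A J = (\<chi> i. if i \<in> (\<Union>j\<in>J. Supp (mu_col A j)) then 1 else 0)"

text \<open>The bilinear pairing on \<open>\<real>\<^sup>n \<times> \<complex>\<^sup>n\<close>, not a Hermitian product.\<close>

definition pairing :: "real ^ 'n \<Rightarrow> complex ^ 'n \<Rightarrow> complex" where
  "pairing \<mu> s = (\<Sum>i\<in>UNIV. complex_of_real (\<mu> $ i) * s $ i)"

definition sing_hyperplane :: "real ^ 'r ^ 'n \<Rightarrow> 'r set \<Rightarrow> nat \<Rightarrow> (complex ^ 'n) set" where
  "sing_hyperplane A J l = {s. pairing (mu_set A J) s = of_nat (card J) - of_nat l}"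

text \<open>The value \<open>l = 0\<close> gives an actual singularity even when \<open>\<mu>\<^sub>J\<close> is a canonical basis vector: for
  \<open>n = r = 1\<close> and \<open>a\<^sub>1\<^sub>1 = 1\<close> the function is the Riemann zeta function, with its pole at
  \<open>s = 1 = |J| - 0\<close>.\<close>

end

theory Submission
  imports Defs "HOL-Complex_Analysis.Complex_Analysis"
begin

text \<open>Substituting \<open>t\<^sub>i = exp x\<^sub>i\<close> in the Gamma integrals gives
  \<open>\<Prod>\<^sub>i \<Gamma>(s\<^sub>i) \<zeta>\<^sub>A(s) = \<integral> exp \<langle>s, x\<rangle> \<Prod>\<^sub>j (exp l\<^sub>j(x) - 1)\<^sup>-\<^sup>1 dx\<close> over \<open>\<real>\<^sup>n\<close>, where
  \<open>l\<^sub>j(x) = \<Sum>\<^sub>i a\<^sub>i\<^sub>j exp x\<^sub>i\<close>. Integrating by parts in the direction \<open>\<one>\<^sub>I\<close>, under which exactly the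
  \<open>l\<^sub>j\<close> with column support inside \<open>I\<close> are homogeneous, multiplies the integral by
  \<open>\<Sum>\<^sub>i\<^sub>\<in>\<^sub>I s\<^sub>i + w\<close> for an integer \<open>w\<close> and expresses it by integrals of the same kind that converge
  further to the left. Initially \<open>w = -|J|\<close> with \<open>J\<close> the set of these columns, and \<open>w\<close> grows by at
  least \<open>1\<close> with each step; only unions \<open>I\<close> of supports and singletons are needed. For a singleton \<open>I = {i}\<close> the
  zeros of \<open>1 / \<Gamma>(s\<^sub>i)\<close> cancel the factors with \<open>w \<ge> 0\<close>. The identity theorem carries the resulting
  pole set over to every meromorphic extension.\<close>

section \<open>Holomorphic functions of several variables\<close>

text \<open>The forms \<open>l_j\<close> are positive, so \<open>1 / (exp l_j - 1)\<close> is
  singular only at infinity of the \<open>x\<close>-space, where all \<open>x_i\<close> in the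
  support of column \<open>j\<close> tend to \<open>-\<infinity>\<close>. Writing it as
  \<open>1 / l_j\<close> times a function whose derivatives all decay exponentially leaves inverse
  powers of forms, and these have an integer degree in every direction \<open>I\<close>. This degree
  decides convergence and is also the integer in the scalar gained by parts. The danger is that a
  form not homogeneous in the variables of \<open>I\<close> gains an inverse power under
  differentiation, which might destroy convergence for another set. The new power always comes with
  some \<open>exp x_i\<close> from the support of the same form, so no degree ever drops. The linear
  factors that really occur are not tracked. Where the relevant partial sums of real parts exceed
  \<open>-M\<close>, one fixed finite product of linear factors makes the zeta function holomorphic.
  These tubes are convex and exhaust the space as \<open>M\<close> grows. The number
  \<open>l\<close> of the theorem is \<open>w + |J|\<close>; since \<open>w\<close> starts at
  \<open>-|J|\<close>, it starts at 0.\<close>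

lemma holomorphic_Cn_onI:
  assumes "open U"
    and "\<And>z. z \<in> U \<Longrightarrow> (f has_derivative f' z) (at z)"
    and "\<And>z c v. z \<in> U \<Longrightarrow> f' z (c *s v) = c * f' z v"
  shows "holomorphic_Cn_on f U"
  using assms unfolding holomorphic_Cn_on_def by blast

lemma holomorphic_Cn_onE:
  assumes "holomorphic_Cn_on f U" "z \<in> U"
  obtains f' where "(f has_derivative f') (at z)" "\<And>c v. f' (c *s v) = c * f' v"
  using assms unfolding holomorphic_Cn_on_def by blast

lemma holomorphic_Cn_on_open: "holomorphic_Cn_on f U \<Longrightarrow> open U"
  by (simp add: holomorphic_Cn_on_def)

lemma holomorphic_Cn_on_subset:
  "holomorphic_Cn_on f U \<Longrightarrow> open V \<Longrightarrow> V \<subseteq> U \<Longrightarrow> holomorphic_Cn_on f V"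
  unfolding holomorphic_Cn_on_def by blast

lemma holomorphic_Cn_on_imp_continuous_on: "holomorphic_Cn_on f U \<Longrightarrow> continuous_on U f"
  unfolding holomorphic_Cn_on_def
  by (meson continuous_at_imp_continuous_on has_derivative_continuous)

lemma holomorphic_Cn_on_const: "open U \<Longrightarrow> holomorphic_Cn_on (\<lambda>z. c) U"
  by (rule holomorphic_Cn_onI[where f' = "\<lambda>z v. 0"]) auto

lemma holomorphic_Cn_on_nth: "open U \<Longrightarrow> holomorphic_Cn_on (\<lambda>z. z $ i) U"
  by (rule holomorphic_Cn_onI[where f' = "\<lambda>z v. v $ i"])
     (auto intro!: bounded_linear_imp_has_derivative bounded_linear_vec_nth)

lemma holomorphic_Cn_on_add:
  assumes "holomorphic_Cn_on f U" "holomorphic_Cn_on g U"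
  shows "holomorphic_Cn_on (\<lambda>z. f z + g z) U"
  unfolding holomorphic_Cn_on_def
proof (intro conjI ballI)
  show "open U" using assms(1) by (rule holomorphic_Cn_on_open)
  fix z assume z: "z \<in> U"
  obtain f' where f': "(f has_derivative f') (at z)" "\<And>c v. f' (c *s v) = c * f' v"
    using holomorphic_Cn_onE[OF assms(1) z] by blast
  obtain g' where g': "(g has_derivative g') (at z)" "\<And>c v. g' (c *s v) = c * g' v"
    using holomorphic_Cn_onE[OF assms(2) z] by blast
  show "\<exists>h'. ((\<lambda>z. f z + g z) has_derivative h') (at z) \<and> (\<forall>c v. h' (c *s v) = c * h' v)"
    by (rule exI[of _ "\<lambda>v. f' v + g' v"])
       (use f' g' in \<open>auto intro!: derivative_eq_intros simp: algebra_simps\<close>)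
qed

lemma holomorphic_Cn_on_mult:
  assumes "holomorphic_Cn_on f U" "holomorphic_Cn_on g U"
  shows "holomorphic_Cn_on (\<lambda>z. f z * g z) U"
  unfolding holomorphic_Cn_on_def
proof (intro conjI ballI)
  show "open U" using assms(1) by (rule holomorphic_Cn_on_open)
  fix z assume z: "z \<in> U"
  obtain f' where f': "(f has_derivative f') (at z)" "\<And>c v. f' (c *s v) = c * f' v"
    using holomorphic_Cn_onE[OF assms(1) z] by blast
  obtain g' where g': "(g has_derivative g') (at z)" "\<And>c v. g' (c *s v) = c * g' v"
    using holomorphic_Cn_onE[OF assms(2) z] by blast
  show "\<exists>h'. ((\<lambda>z. f z * g z) has_derivative h') (at z) \<and> (\<forall>c v. h' (c *s v) = c * h' v)"
    by (rule exI[of _ "\<lambda>v. f z * g' v + f' v * g z"])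
       (use f' g' in \<open>auto intro!: derivative_eq_intros simp: algebra_simps\<close>)
qed

lemma holomorphic_Cn_on_compose:
  assumes f: "holomorphic_Cn_on f U" and g: "g holomorphic_on V" "open V" "f ` U \<subseteq> V"
  shows "holomorphic_Cn_on (\<lambda>z. g (f z)) U"
  unfolding holomorphic_Cn_on_def
proof (intro conjI ballI)
  show "open U" using f by (rule holomorphic_Cn_on_open)
  fix z assume z: "z \<in> U"
  obtain f' where f': "(f has_derivative f') (at z)" "\<And>c v. f' (c *s v) = c * f' v"
    using holomorphic_Cn_onE[OF f z] by blast
  have "(g has_field_derivative deriv g (f z)) (at (f z))"
    using g z by (intro holomorphic_derivI[of g V]) auto
  then have "(g has_derivative (*) (deriv g (f z))) (at (f z))"
    by (simp add: has_field_derivative_def)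
  from has_derivative_compose[OF f'(1) this]
  have "((\<lambda>z. g (f z)) has_derivative (\<lambda>v. deriv g (f z) * f' v)) (at z)" .
  then show "\<exists>h'. ((\<lambda>z. g (f z)) has_derivative h') (at z) \<and> (\<forall>c v. h' (c *s v) = c * h' v)"
    using f'(2) by (auto simp: algebra_simps)
qed

lemma holomorphic_Cn_on_diff:
  assumes "holomorphic_Cn_on f U" "holomorphic_Cn_on g U"
  shows "holomorphic_Cn_on (\<lambda>z. f z - g z) U"
proof -
  have "holomorphic_Cn_on (\<lambda>z. f z + (- 1) * g z) U"
    by (intro holomorphic_Cn_on_add holomorphic_Cn_on_mult holomorphic_Cn_on_const
        holomorphic_Cn_on_open[OF assms(1)] assms)
  then show ?thesis by simp
qed

lemma holomorphic_Cn_on_sum: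
  assumes "open U" "\<And>k. k \<in> K \<Longrightarrow> holomorphic_Cn_on (f k) U"
  shows "holomorphic_Cn_on (\<lambda>z. \<Sum>k\<in>K. f k z) U"
  using assms(2)
  by (induction K rule: infinite_finite_induct)
     (auto intro: holomorphic_Cn_on_const holomorphic_Cn_on_add assms(1))

lemma holomorphic_Cn_on_prod:
  assumes "open U" "\<And>k. k \<in> K \<Longrightarrow> holomorphic_Cn_on (f k) U"
  shows "holomorphic_Cn_on (\<lambda>z. \<Prod>k\<in>K. f k z) U"
  using assms(2)
  by (induction K rule: infinite_finite_induct)
     (auto intro: holomorphic_Cn_on_const holomorphic_Cn_on_mult assms(1))

lemma holomorphic_Cn_on_divide:
  assumes "holomorphic_Cn_on f U" "holomorphic_Cn_on g U" "\<And>z. z \<in> U \<Longrightarrow> g z \<noteq> 0"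
  shows "holomorphic_Cn_on (\<lambda>z. f z / g z) U"
proof -
  have "inverse holomorphic_on - {0::complex}"
    by (intro holomorphic_intros) auto
  then have "holomorphic_Cn_on (\<lambda>z. inverse (g z)) U"
    by (rule holomorphic_Cn_on_compose[OF assms(2), of inverse "- {0}"])
      (use assms(3) in \<open>auto simp: open_Compl\<close>)
  from holomorphic_Cn_on_mult[OF assms(1) this] show ?thesis
    by (simp add: divide_inverse)
qed

section \<open>Complex lines and the identity principle\<close>

lemma bounded_linear_complex_line: "bounded_linear (\<lambda>t::complex. t *s (w :: complex ^ 'n))"
proof -
  have "linear (\<lambda>t::complex. t *s (w :: complex ^ 'n))"
    by (rule linearI) (simp_all add: vec_eq_iff algebra_simps)
  then show ?thesis by (simp add: linear_conv_bounded_linear)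
qed

lemma holomorphic_on_complex_line:
  fixes z w :: "complex ^ 'n"
  assumes "holomorphic_Cn_on f U"
  shows "(\<lambda>t. f (z + t *s w)) holomorphic_on {t. z + t *s w \<in> U}"
proof -
  have "((\<lambda>t. f (z + t *s w)) has_field_derivative f' w) (at t)"
    if "(f has_derivative f') (at (z + t *s w))" "\<And>c v. f' (c *s v) = c * f' v" for t f'
  proof -
    have "((\<lambda>t. z + t *s w) has_derivative (\<lambda>t. 0 + t *s w)) (at t)"
      by (intro has_derivative_add has_derivative_const bounded_linear_imp_has_derivative
          bounded_linear_complex_line)
    then have "((\<lambda>t. f (z + t *s w)) has_derivative (\<lambda>t. f' (0 + t *s w))) (at t)"
      using that(1) by (rule has_derivative_compose)
    then have "((\<lambda>t. f (z + t *s w)) has_derivative (\<lambda>t. f' w * t)) (at t)"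
      using that(2) by (simp add: mult.commute)
    then show ?thesis by (simp add: has_field_derivative_def mult_commute_abs)
  qed
  note line = this
  show ?thesis
    unfolding holomorphic_on_def
  proof
    fix t assume "t \<in> {t. z + t *s w \<in> U}"
    then obtain f' where "(f has_derivative f') (at (z + t *s w))" "\<And>c v. f' (c *s v) = c * f' v"
      using holomorphic_Cn_onE[OF assms, of "z + t *s w"] by auto
    from line[OF this]
    have "(\<lambda>t. f (z + t *s w)) field_differentiable at t"
      unfolding field_differentiable_def by (rule exI)
    then show "(\<lambda>t. f (z + t *s w)) field_differentiable at t within {t. z + t *s w \<in> U}"
      by (rule field_differentiable_at_within)
  qed
qed

text \<open>Join \<open>z\<close> to a point of \<open>V\<close> by a complex line. The parameters
  that stay in the convex set \<open>U\<close> form a convex, hence connected, set containing 0 and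
  1, so one-variable analytic continuation carries the zero to \<open>z\<close>.\<close>

lemma holomorphic_Cn_identity_convex:
  assumes f: "holomorphic_Cn_on f U" "convex U"
    and V: "open V" "V \<noteq> {}" "V \<subseteq> U" "\<And>z. z \<in> V \<Longrightarrow> f z = 0" and z: "z \<in> U"
  shows "f z = 0"
proof -
  obtain w where w: "w \<in> V" using V(2) by blast
  define line where "line = (\<lambda>t. w + t *s (z - w))"
  have cont: "continuous_on UNIV line" unfolding line_def
    by (rule continuous_on_add[OF continuous_on_const
        linear_continuous_on[OF bounded_linear_complex_line]])
  have open1: "open {t. line t \<in> U}" "open {t. line t \<in> V}"
    using open_vimage[OF holomorphic_Cn_on_open[OF f(1)] cont] open_vimage[OF V(1) cont]
    by (auto simp: vimage_def)
  have line_aff: "line ((1 - u) *\<^sub>R a + u *\<^sub>R b) = (1 - u) *\<^sub>R line a + u *\<^sub>R line b" for a b u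
    by (simp add: line_def vec_eq_iff algebra_simps)
  have "convex {t. line t \<in> U}"
    using f(2) unfolding convex_alt by (simp add: line_aff)
  then have "connected {t. line t \<in> U}" by (rule convex_connected)
  moreover have "0 \<in> {t. line t \<in> V}" using w by (simp add: line_def)
  moreover have "1 \<in> {t. line t \<in> U}" using z by (simp add: line_def)
  moreover have "(\<lambda>t. f (line t)) holomorphic_on {t. line t \<in> U}"
    unfolding line_def by (rule holomorphic_on_complex_line[OF f(1)])
  moreover have "{t. line t \<in> V} \<subseteq> {t. line t \<in> U}" using V(3) by blast
  moreover have "f (line t) = 0" if "t \<in> {t. line t \<in> V}" for t using that V(4) by blast
  ultimately have "f (line 1) = 0"
    by (intro analytic_continuation_open[OF open1(2,1), of "\<lambda>t. f (line t)" "\<lambda>t. 0" 1])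
      (simp_all only: holomorphic_on_const, auto)
  then show ?thesis by (simp add: line_def)
qed

text \<open>The interior of the zero set is closed in \<open>U\<close>: a ball in \<open>U\<close>
  around a limit point meets it, and the convex case spreads the zeros over that ball. By
  connectedness an open set of zeros would be followed by vanishing on all of
  \<open>U\<close>.\<close>

lemma holomorphic_Cn_nonzero_dense:
  assumes h: "holomorphic_Cn_on h U" "connected U" "\<exists>z\<in>U. h z \<noteq> 0"
    and V: "open V" "V \<noteq> {}" "V \<subseteq> U"
  shows "\<exists>z\<in>V. h z \<noteq> 0"
proof (rule ccontr)
  assume neg: "\<not> (\<exists>z\<in>V. h z \<noteq> 0)"
  have U: "open U" using h(1) by (rule holomorphic_Cn_on_open)
  define E where "E = interior {z \<in> U. h z = 0}"
  have "open (U - E)"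
  proof (subst open_contains_ball, intro ballI)
    fix p assume p: "p \<in> U - E"
    then obtain e where e: "e > 0" "ball p e \<subseteq> U" using U open_contains_ball by blast
    have "ball p e \<inter> E = {}"
    proof (rule ccontr)
      assume "ball p e \<inter> E \<noteq> {}"
      moreover have "h z = 0" if "z \<in> E" for z using that interior_subset by (auto simp: E_def)
      moreover have "open (ball p e \<inter> E)" unfolding E_def by (intro open_Int open_ball open_interior)
      ultimately have "h z = 0" if "z \<in> ball p e" for z
        using holomorphic_Cn_identity_convex[OF holomorphic_Cn_on_subset[OF h(1) open_ball e(2)]
            convex_ball, of "ball p e \<inter> E" z] that by blast
      then have "ball p e \<subseteq> {z \<in> U. h z = 0}" using e by auto
      then have "p \<in> E" unfolding E_def by (meson e(1) interiorI centre_in_ball open_ball)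
      then show False using p by blast
    qed
    then show "\<exists>e>0. ball p e \<subseteq> U - E" using e by blast
  qed
  moreover have "open E" "E \<subseteq> U" unfolding E_def using interior_subset by auto
  moreover have "V \<subseteq> E" unfolding E_def using V neg by (intro interior_maximal) auto
  moreover have "\<not> U \<subseteq> E" using h(3) interior_subset unfolding E_def by blast
  moreover have "E \<inter> (U - E) \<inter> U = {}" "U \<subseteq> E \<union> (U - E)" by auto
  ultimately have "E \<inter> U = {} \<or> (U - E) \<inter> U = {}"
    using connectedD[OF h(2), of E "U - E"] by simp
  with \<open>V \<subseteq> E\<close> \<open>\<not> U \<subseteq> E\<close> V show False by auto
qed

lemma holomorphic_Cn_eq_extend:
  assumes "holomorphic_Cn_on f U" "holomorphic_Cn_on g U" "connected U"
    and "open V" "V \<noteq> {}" "V \<subseteq> U" "\<And>z. z \<in> V \<Longrightarrow> f z = g z" "z \<in> U"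
  shows "f z = g z"
proof (rule ccontr)
  assume "f z \<noteq> g z"
  then have "\<exists>z\<in>U. f z - g z \<noteq> 0" using assms(8) by auto
  from holomorphic_Cn_nonzero_dense[OF holomorphic_Cn_on_diff[OF assms(1,2)] assms(3) this assms(4-6)]
  show False using assms(7) by auto
qed

text \<open>A meromorphic \<open>F\<close> may take junk values on a thin set; the identity principle therefore is about
  agreement off the zeros of some holomorphic function near each point.\<close>

lemma meromorphic_Cn_identity:
  assumes F: "meromorphic_Cn F"
    and N: "holomorphic_Cn_on N \<Omega>" and D: "holomorphic_Cn_on D \<Omega>" and \<Omega>: "connected \<Omega>"
    and W: "open W" "W \<noteq> {}" "W \<subseteq> \<Omega>" "\<And>z. z \<in> W \<Longrightarrow> F z * D z = N z"
    and p: "p \<in> \<Omega>"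
  shows "\<exists>U h. p \<in> U \<and> connected U \<and> U \<subseteq> \<Omega> \<and> holomorphic_Cn_on h U \<and> (\<exists>z\<in>U. h z \<noteq> 0) \<and>
           (\<forall>z\<in>U. h z \<noteq> 0 \<longrightarrow> F z * D z = N z)"
proof -
  have op: "open \<Omega>" using N by (rule holomorphic_Cn_on_open)
  define good where "good = (\<lambda>U h. connected U \<and> U \<subseteq> \<Omega> \<and> holomorphic_Cn_on h U \<and>
      (\<exists>z\<in>U. h z \<noteq> 0) \<and> (\<forall>z\<in>U. h z \<noteq> 0 \<longrightarrow> F z * D z = N z))"
  \<comment> \<open>\<open>E\<close> collects the points near which the claim holds with some
    witness. It is open by construction, \<open>step\<close> makes it closed in
    \<open>\<Omega>\<close>, and \<open>W\<close> makes it nonempty.\<close>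
  define E where "E = \<Union>{U. \<exists>h. good U h}"
  have E_open: "open E" unfolding E_def good_def by (auto dest: holomorphic_Cn_on_open)
  have step: "ball q e \<subseteq> E"
    if q: "q \<in> \<Omega>" and U: "q \<in> U" "connected U" "holomorphic_Cn_on g U" "holomorphic_Cn_on h U"
        "\<exists>z\<in>U. h z \<noteq> 0" "\<forall>z\<in>U. h z \<noteq> 0 \<longrightarrow> F z = g z / h z"
      and e: "e > 0" "ball q e \<subseteq> U \<inter> \<Omega>" and meets: "ball q e \<inter> E \<noteq> {}" for q U g h e
  proof -
    have hol: "holomorphic_Cn_on g (ball q e)" "holomorphic_Cn_on h (ball q e)"
      "holomorphic_Cn_on N (ball q e)" "holomorphic_Cn_on D (ball q e)"
      using e U N D by (auto intro: holomorphic_Cn_on_subset)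
    obtain y U' h' where y: "y \<in> ball q e" "y \<in> U'" "good U' h'"
      using meets unfolding E_def by blast
    have U': "open U'" using y by (auto simp: good_def dest: holomorphic_Cn_on_open)
    have ne: "\<exists>z\<in>V. h z \<noteq> 0" if "open V" "V \<noteq> {}" "V \<subseteq> U" for V
      using holomorphic_Cn_nonzero_dense[OF U(4,2,5) that] .
    have ne': "\<exists>z\<in>V. h' z \<noteq> 0" if "open V" "V \<noteq> {}" "V \<subseteq> U'" for V
      using y(3) that holomorphic_Cn_nonzero_dense unfolding good_def by blast
    define V where "V = {z \<in> ball q e \<inter> U'. h z \<noteq> 0}"
    have V_eq: "V = (ball q e \<inter> U') \<inter> h -` (- {0})" by (auto simp: V_def)
    have V: "open V" unfolding V_eq using U'
      by (intro continuous_open_preimage holomorphic_Cn_on_imp_continuous_on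
          holomorphic_Cn_on_subset[OF hol(2)] open_Int) auto
    have Vne: "V \<noteq> {}"     proof -
      have "\<exists>z\<in>ball q e \<inter> U'. h z \<noteq> 0"
        using ne[of "ball q e \<inter> U'"] y(1,2) U' e by blast
      then show ?thesis unfolding V_def by blast
    qed
    define V' where "V' = {z \<in> V. h' z \<noteq> 0}"
    have V'_eq: "V' = V \<inter> h' -` (- {0})" by (auto simp: V'_def)
    have "holomorphic_Cn_on h' V"
    proof (rule holomorphic_Cn_on_subset[OF _ V])
      show "holomorphic_Cn_on h' U'" using y(3) unfolding good_def by blast
      show "V \<subseteq> U'" unfolding V_def by blast
    qed
    then have V': "open V'" unfolding V'_eq using V
      by (intro continuous_open_preimage holomorphic_Cn_on_imp_continuous_on) (simp_all add: open_Compl)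
    have V'ne: "V' \<noteq> {}"     proof -
      have "V \<subseteq> U'" unfolding V_def by blast
      from ne'[OF V Vne this] show ?thesis unfolding V'_def by blast
    qed
    have eq: "g z * D z = N z * h z" if "z \<in> V'" for z
    proof -
      have "z \<in> U" "z \<in> U'" "h z \<noteq> 0" "h' z \<noteq> 0"
        using that e unfolding V'_def V_def by blast+
      then have "F z = g z / h z" "F z * D z = N z" "h z \<noteq> 0"
        using U(6) y(3) unfolding good_def by blast+
      then have "g z = F z * h z" and N: "N z = F z * D z" by simp_all
      then show ?thesis by (simp only: mult_ac)
    qed
    \<comment> \<open>After clearing denominators both sides are holomorphic, so agreement on
      \<open>V'\<close> spreads over the ball even though \<open>F\<close> is arbitrary on thin
      sets. Dividing by \<open>h\<close> recovers the relation for \<open>F\<close>, now with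
      \<open>h\<close> as witness.\<close>
    have "g z * D z = N z * h z" if "z \<in> ball q e" for z
      by (rule holomorphic_Cn_eq_extend[OF _ _ _ V' V'ne _ eq that])
         (simp_all add: holomorphic_Cn_on_mult hol, auto simp: V'_def V_def)
    note ball_eq = this
    have "F z * D z = N z" if z: "z \<in> ball q e" "h z \<noteq> 0" for z
    proof -
      have "F z = g z / h z" using U(6) e z by blast
      then have "F z * D z = (g z * D z) / h z" by simp
      also have "\<dots> = N z" using ball_eq[OF z(1)] z(2) by simp
      finally show ?thesis .
    qed
    then have "\<forall>z\<in>ball q e. h z \<noteq> 0 \<longrightarrow> F z * D z = N z" by blast
    moreover have "ball q e \<noteq> {}" "ball q e \<subseteq> U" "ball q e \<subseteq> \<Omega>" using e by auto
    moreover from this have "\<exists>z\<in>ball q e. h z \<noteq> 0" using ne[of "ball q e"] by simp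
    ultimately have "good (ball q e) h" unfolding good_def using hol(2) connected_ball by blast
    then show ?thesis unfolding E_def by blast
  qed
  have loc: "\<exists>e>0. ball q e \<subseteq> \<Omega> \<and> (ball q e \<inter> E \<noteq> {} \<longrightarrow> ball q e \<subseteq> E)" if q: "q \<in> \<Omega>" for q
  proof -
    obtain U g h where U: "q \<in> U" "connected U" "holomorphic_Cn_on g U" "holomorphic_Cn_on h U"
        "\<exists>z\<in>U. h z \<noteq> 0" "\<forall>z\<in>U. h z \<noteq> 0 \<longrightarrow> F z = g z / h z"
      using F unfolding meromorphic_Cn_def by blast
    have "open (U \<inter> \<Omega>)" using op U(3) holomorphic_Cn_on_open by blast
    then obtain e where "e > 0" "ball q e \<subseteq> U \<inter> \<Omega>"
      using U(1) q openE[of "U \<inter> \<Omega>" q] by blast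
    then show ?thesis using step[OF q U] by blast
  qed
  have "open (\<Omega> - E)"
  proof (subst open_contains_ball, intro ballI)
    fix q assume q: "q \<in> \<Omega> - E"
    then obtain e where "e > 0" "ball q e \<subseteq> \<Omega>" "ball q e \<inter> E \<noteq> {} \<longrightarrow> ball q e \<subseteq> E"
      using loc by blast
    moreover have "q \<in> ball q e" using \<open>e > 0\<close> by simp
    ultimately show "\<exists>e>0. ball q e \<subseteq> \<Omega> - E" using q by blast
  qed
  moreover have "E \<inter> \<Omega> \<noteq> {}"
  proof -
    obtain w where "w \<in> W" using W(2) by blast
    then obtain e where e: "e > 0" "ball w e \<subseteq> W" using W(1) open_contains_ball by blast
    have "good (ball w e) (\<lambda>z. 1)"
      unfolding good_def using e W by (auto intro!: holomorphic_Cn_on_const exI[of _ w])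
    moreover have "w \<in> ball w e" using e by simp
    ultimately show ?thesis using e W(3) unfolding E_def by blast
  qed
  moreover have "E \<inter> (\<Omega> - E) \<inter> \<Omega> = {}" "\<Omega> \<subseteq> E \<union> (\<Omega> - E)" by auto
  ultimately have "(\<Omega> - E) \<inter> \<Omega> = {}"
    using connectedD[OF \<Omega> E_open, of "\<Omega> - E"] by simp
  then have "\<Omega> \<subseteq> E" by auto
  then obtain U h where "p \<in> U" "good U h" using p unfolding E_def by blast
  then show ?thesis unfolding good_def by blast
qed

section \<open>Integrals over Euclidean space\<close>

text \<open>Fubini for products of one-variable functions. Lebesgue measure on
  \<open>real ^ 'n\<close> is the image of a product measure indexed by \<open>Basis\<close>, so the
  work is to translate that index to \<open>'n\<close> through the axis vectors.\<close>

lemma lborel_integral_prod_vec: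
  fixes f :: "'n::finite \<Rightarrow> real \<Rightarrow> 'b::{real_normed_field,banach,second_countable_topology}"
  assumes int: "\<And>i. integrable lborel (f i)"
  shows "integrable lborel (\<lambda>x::real^'n. \<Prod>i\<in>UNIV. f i (x $ i))"
    and "(\<integral>x. (\<Prod>i\<in>UNIV. f i ((x::real^'n) $ i)) \<partial>lborel) = (\<Prod>i\<in>UNIV. \<integral>t. f i t \<partial>lborel)"
proof -
  interpret product_sigma_finite "\<lambda>b::real^'n. lborel :: real measure" by standard
  define P where "P = (\<Pi>\<^sub>M b\<in>(Basis :: (real^'n) set). (lborel :: real measure))"
  define e where "e = (\<lambda>i. axis i (1::real) :: real^'n)"
  define T where "T = (\<lambda>g. \<Sum>b\<in>Basis. g b *\<^sub>R (b :: real^'n))"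
  have inj: "inj e" unfolding e_def inj_def by (simp add: axis_eq_axis)
  have bas: "Basis = range e" unfolding e_def Basis_vec_def by auto
  define F where "F = (\<lambda>b. f (inv e b))"
  have T_nth: "T g $ i = g (e i)" for g i
  proof -
    have "T g $ i = (\<Sum>j\<in>UNIV. g (e j) * (e j $ i))"
      unfolding T_def bas by (subst sum.reindex[OF inj]) simp
    also have "\<dots> = (\<Sum>j\<in>UNIV. if j = i then g (e j) else 0)"
      by (rule sum.cong) (auto simp: e_def axis_def)
    finally show ?thesis by simp
  qed
  have prodF: "(\<Prod>b\<in>Basis. F b (g b)) = (\<Prod>i\<in>UNIV. f i (T g $ i))" for g
    unfolding bas by (subst prod.reindex[OF inj]) (simp add: F_def T_nth inv_f_f[OF inj])
  have T_meas: "T \<in> measurable P borel" unfolding T_def P_def by measurable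
  have lb: "lborel = distr P borel T" unfolding P_def T_def by (rule lborel_eq)
  have meas_f: "f i \<in> borel_measurable borel" for i
    using int[of i] by (simp add: integrable_iff_bounded)
  have meas: "(\<lambda>x::real^'n. \<Prod>i\<in>UNIV. f i (x $ i)) \<in> borel_measurable borel"
    by (intro borel_measurable_prod measurable_compose[OF _ meas_f]) simp
  have "integrable P (\<lambda>g. \<Prod>b\<in>Basis. F b (g b))" unfolding P_def
    by (rule product_integrable_prod) (auto simp: F_def int)
  then show "integrable lborel (\<lambda>x::real^'n. \<Prod>i\<in>UNIV. f i (x $ i))"
    unfolding lb integrable_distr_eq[OF T_meas meas] prodF .
  have "(\<integral>x. (\<Prod>i\<in>UNIV. f i ((x::real^'n) $ i)) \<partial>lborel) = (\<integral>g. (\<Prod>b\<in>Basis. F b (g b)) \<partial>P)"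
    unfolding lb integral_distr[OF T_meas meas] prodF ..
  also have "\<dots> = (\<Prod>b\<in>Basis. \<integral>t. F b t \<partial>lborel)" unfolding P_def
    by (rule product_integral_prod) (auto simp: F_def int)
  also have "\<dots> = (\<Prod>i\<in>UNIV. \<integral>t. f i t \<partial>lborel)"
    unfolding bas by (subst prod.reindex[OF inj]) (simp add: F_def inv_f_f[OF inj])
  finally show "(\<integral>x. (\<Prod>i\<in>UNIV. f i ((x::real^'n) $ i)) \<partial>lborel) = (\<Prod>i\<in>UNIV. \<integral>t. f i t \<partial>lborel)" .
qed

text \<open>Substitute \<open>t = L * exp x\<close> in Euler's integral; the Jacobian
  \<open>L * exp x\<close> raises the exponent \<open>s - 1\<close> to \<open>s\<close>.\<close>

lemma Gamma_integral_exp: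
  assumes s: "Re s > 0" and L: "L > 0"
  shows "integrable lborel (\<lambda>x::real. exp (s * of_real x) * exp (- of_real (L * exp x)))"
    and "(\<integral>x. exp (s * of_real x) * exp (- of_real (L * exp x)) \<partial>lborel)
           = Gamma s * complex_of_real L powr (- s)"
proof -
  let ?g = "\<lambda>x::real. L * exp x"
  let ?f = "\<lambda>t. complex_of_real t powr (s - 1) / of_real (exp t)"
  let ?k = "\<lambda>x::real. exp (s * of_real x) * exp (- of_real (L * exp x))"
  have img: "?g ` UNIV = {0<..}"
  proof -
    have "y \<in> range ?g" if "y > 0" for y
      using that L by (intro image_eqI[of _ _ "ln (y / L)"]) auto
    then show ?thesis using L by auto
  qed
  have eq: "(\<lambda>x. \<bar>?g x\<bar> *\<^sub>R ?f (?g x)) = (\<lambda>x. of_real L powr s * ?k x)"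
  proof
    fix x :: real
    have pos: "?g x > 0" using L by simp
    have "\<bar>?g x\<bar> *\<^sub>R ?f (?g x) = of_real (?g x) powr 1 * of_real (?g x) powr (s - 1) / of_real (exp (?g x))"
      using pos L by (simp add: scaleR_conv_of_real)
    also have "of_real (?g x) powr 1 * of_real (?g x) powr (s - 1) = complex_of_real (?g x) powr s"
      by (subst powr_add[symmetric]) simp
    also have "\<dots> = of_real L powr s * exp (s * of_real x)"
    proof -
      have "complex_of_real (?g x) powr s = exp (s * of_real (ln (?g x)))"
        using pos L by (simp add: powr_def Ln_of_real del: of_real_mult)
      also have "ln (?g x) = ln L + x" using L by (simp add: ln_mult)
      finally show ?thesis using L by (simp add: powr_def Ln_of_real exp_add algebra_simps)
    qed
    finally show "\<bar>?g x\<bar> *\<^sub>R ?f (?g x) = of_real L powr s * ?k x"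
      by (simp add: exp_minus divide_inverse flip: exp_of_real)
  qed
  have "(\<lambda>x. \<bar>?g x\<bar> *\<^sub>R ?f (?g x)) absolutely_integrable_on UNIV \<and>
        integral UNIV (\<lambda>x. \<bar>?g x\<bar> *\<^sub>R ?f (?g x)) = Gamma s"
  proof (subst has_absolute_integral_change_of_variables_real)
    show "?f absolutely_integrable_on range ?g \<and> integral (range ?g) ?f = Gamma s"
      unfolding img
      using absolutely_integrable_Gamma_integral'[OF s] Gamma_integral_complex'[OF s]
      by (simp add: integral_unique)
    show "inj ?g" using L by (auto intro!: injI)
  qed (auto intro!: derivative_eq_intros)
  then have ai: "(\<lambda>x. of_real L powr s * ?k x) absolutely_integrable_on UNIV"
    and iv: "integral UNIV (\<lambda>x. of_real L powr s * ?k x) = Gamma s"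
    unfolding eq by auto
  have meas: "(\<lambda>x. of_real L powr s * ?k x) \<in> borel_measurable borel"
    by (intro borel_measurable_continuous_onI continuous_intros)
  have int: "integrable lborel (\<lambda>x. of_real L powr s * ?k x)"
    using ai meas by (simp add: set_integrable_def integrable_completion)
  have L0: "complex_of_real L powr s \<noteq> 0" using L by simp
  show k: "integrable lborel ?k"
    using integrable_mult_right[OF int, of "inverse (of_real L powr s)"] L0
    by (simp add: mult.assoc[symmetric])
  have "of_real L powr s * (\<integral>x. ?k x \<partial>lborel) = Gamma s"
    using integral_lborel[OF int] unfolding iv integral_mult_right_zero ..
  then show "(\<integral>x. ?k x \<partial>lborel) = Gamma s * complex_of_real L powr (- s)"
    using L0 by (simp add: powr_minus field_simps)
qed

text \<open>For \<open>x \<le> 0\<close> the Gamma integrand with exponent \<open>\<epsilon>\<close>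
  dominates up to the factor \<open>exp 1\<close>, because \<open>exp x \<le> 1\<close> there; its
  reflection handles the other half line.\<close>

lemma integrable_exp_minus_abs:
  assumes "(\<epsilon>::real) > 0"
  shows "integrable lborel (\<lambda>x::real. exp (- \<epsilon> * \<bar>x\<bar>))"
proof -
  define k where "k = (\<lambda>x::real. norm (exp (of_real \<epsilon> * of_real x) * exp (- complex_of_real (1 * exp x))))"
  have k_eq: "k x = exp (\<epsilon> * x) * exp (- exp x)" for x
    by (simp add: k_def norm_mult)
  have int: "integrable lborel k" unfolding k_def
    using Gamma_integral_exp(1)[of "of_real \<epsilon>" 1] assms by (intro integrable_norm) simp
  then have int': "integrable lborel (\<lambda>x. k (- x))"
    using lborel_integrable_real_affine[of k "-1" 0] by simp
  show ?thesis
  proof (rule Bochner_Integration.integrable_bound)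
    show "integrable lborel (\<lambda>x. exp 1 * (k x + k (- x)))"
      using int int' by simp
    show "(\<lambda>x::real. exp (- \<epsilon> * \<bar>x\<bar>)) \<in> borel_measurable lborel" by measurable
    have k_ge: "exp (- \<epsilon> * \<bar>y\<bar>) \<le> exp 1 * k y" if "y \<le> 0" for y
    proof -
      have "exp (- \<epsilon> * \<bar>y\<bar>) = exp 1 * (exp (\<epsilon> * y) * exp (- 1))"
        using that by (simp flip: exp_add)
      also have "\<dots> \<le> exp 1 * k y" unfolding k_eq using that by simp
      finally show ?thesis .
    qed
    have "exp (- \<epsilon> * \<bar>x\<bar>) \<le> exp 1 * (k x + k (- x))" for x
    proof (cases "x \<le> 0")
      case True
      have "exp 1 * k x \<le> exp 1 * (k x + k (- x))" by (simp add: k_def)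
      then show ?thesis using k_ge[OF True] by linarith
    next
      case False
      have "exp 1 * k (- x) \<le> exp 1 * (k x + k (- x))" by (simp add: k_def)
      moreover have "exp (- \<epsilon> * \<bar>- x\<bar>) \<le> exp 1 * k (- x)" using False by (intro k_ge) simp
      ultimately show ?thesis by (simp only: abs_minus_cancel)
    qed
    moreover have "k x \<ge> 0" for x by (simp add: k_def)
    ultimately show "AE x in lborel. norm (exp (- \<epsilon> * \<bar>x\<bar>)) \<le> norm (exp 1 * (k x + k (- x)))"
      by (intro AE_I2) simp
  qed
qed

lemma integrable_exp_minus_l1:
  assumes "(\<epsilon>::real) > 0"
  shows "integrable lborel (\<lambda>x::real^'n. exp (- \<epsilon> * (\<Sum>i\<in>UNIV. \<bar>x $ i\<bar>)))"
  using lborel_integral_prod_vec(1)[of "\<lambda>i::'n. \<lambda>x. exp (- \<epsilon> * \<bar>x\<bar>)"] integrable_exp_minus_abs[OF assms]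
  by (simp add: exp_sum sum_distrib_left)

section \<open>Integration by parts through translation invariance\<close>

lemma lborel_integral_shift:
  fixes f :: "'a::euclidean_space \<Rightarrow> 'b::{banach,second_countable_topology}"
  assumes f: "f \<in> borel_measurable borel"
  shows "integrable lborel (\<lambda>x. f (c + x)) \<longleftrightarrow> integrable lborel f"
    and "(\<integral>x. f (c + x) \<partial>lborel) = (\<integral>x. f x \<partial>lborel)"
proof -
  have m: "(+) c \<in> measurable lborel borel" by simp
  show "integrable lborel (\<lambda>x. f (c + x)) \<longleftrightarrow> integrable lborel f"
    using integrable_distr_eq[OF m f] by (simp add: lborel_distr_plus)
  show "(\<integral>x. f (c + x) \<partial>lborel) = (\<integral>x. f x \<partial>lborel)"
    using integral_distr[OF m f] by (simp add: lborel_distr_plus)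
qed

text \<open>Integrate \<open>g\<close> over the segment from \<open>x\<close> to
  \<open>x + w\<close>, and then over all \<open>x\<close>. The inner integral is
  \<open>f (w + x) - f x\<close>, which integrates to zero by translation invariance; in the other
  order the result is the integral of \<open>g\<close>. No boundary terms at infinity appear, and
  \<open>w\<close> need not be a coordinate direction.\<close>

lemma integral_directional_derivative_eq_0:
  fixes f g :: "'a::euclidean_space \<Rightarrow> complex"
  assumes f: "integrable lborel f" and g: "integrable lborel g" and cont: "continuous_on UNIV g"
    and deriv: "\<And>x h. ((\<lambda>h. f (x + h *\<^sub>R w)) has_vector_derivative g (x + h *\<^sub>R w)) (at h)"
  shows "(\<integral>x. g x \<partial>lborel) = 0"
proof -
  define k where "k = (\<lambda>(h::real, x). indicator {0..1} h *\<^sub>R g (x + h *\<^sub>R w))"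
  have g_meas: "g \<in> borel_measurable borel" using cont by (rule borel_measurable_continuous_onI)
  have f_meas: "f \<in> borel_measurable borel" using f by simp
  have g_line: "continuous_on UNIV (\<lambda>h. g (x + h *\<^sub>R w))" for x
    by (rule continuous_on_compose2[OF cont]) (auto intro!: continuous_intros)
  have shift: "(\<integral>x. g (x + h *\<^sub>R w) \<partial>lborel) = (\<integral>x. g x \<partial>lborel)"
    "integrable lborel (\<lambda>x. g (x + h *\<^sub>R w))"
    "(\<integral>x. norm (g (x + h *\<^sub>R w)) \<partial>lborel) = (\<integral>x. norm (g x) \<partial>lborel)" for h
  proof -
    have n: "(\<lambda>x. norm (g x)) \<in> borel_measurable borel" using g_meas by measurable
    show "(\<integral>x. g (x + h *\<^sub>R w) \<partial>lborel) = (\<integral>x. g x \<partial>lborel)"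
      using lborel_integral_shift(2)[OF g_meas, of "h *\<^sub>R w"] by (simp add: add.commute)
    show "integrable lborel (\<lambda>x. g (x + h *\<^sub>R w))"
      using lborel_integral_shift(1)[OF g_meas, of "h *\<^sub>R w"] g by (simp add: add.commute)
    show "(\<integral>x. norm (g (x + h *\<^sub>R w)) \<partial>lborel) = (\<integral>x. norm (g x) \<partial>lborel)"
      using lborel_integral_shift(2)[OF n, of "h *\<^sub>R w"] by (simp add: add.commute)
  qed
  have k_meas: "k \<in> borel_measurable (lborel \<Otimes>\<^sub>M lborel)"
  proof -
    have "continuous_on UNIV (\<lambda>p::real \<times> 'a. g (snd p + fst p *\<^sub>R w))"
      by (rule continuous_on_compose2[OF cont]) (auto intro!: continuous_intros)
    then have "(\<lambda>p::real \<times> 'a. g (snd p + fst p *\<^sub>R w)) \<in> borel_measurable borel"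
      by (rule borel_measurable_continuous_onI)
    then have [measurable]: "(\<lambda>p::real \<times> 'a. g (snd p + fst p *\<^sub>R w)) \<in> borel_measurable (lborel \<Otimes>\<^sub>M lborel)"
      by (simp add: lborel_prod)
    show ?thesis unfolding k_def case_prod_beta by measurable
  qed
  have ind: "integrable lborel (\<lambda>h::real. indicator {0..1} h *\<^sub>R (c::'b::{banach,second_countable_topology}))" for c
    by (intro integrable_scaleR_left integrable_real_indicator) auto
  have k_int: "integrable (lborel \<Otimes>\<^sub>M lborel) k"
  proof (rule lborel_pair.Fubini_integrable[OF k_meas])
    have "(\<lambda>h::real. \<integral>x. norm (k (h, x)) \<partial>lborel) = (\<lambda>h. indicator {0..1} h *\<^sub>R (\<integral>x. norm (g x) \<partial>lborel))"
      by (auto simp: k_def shift(3) indicator_def)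
    then show "integrable lborel (\<lambda>h::real. \<integral>x. norm (k (h, x)) \<partial>lborel)"
      using ind by simp
    show "AE h in lborel. integrable lborel (\<lambda>x. k (h, x))"
      by (intro AE_I2) (simp add: k_def shift(2))
  qed
  have "(\<integral>x. (\<integral>h. k (h, x) \<partial>lborel) \<partial>lborel) = (\<integral>h. (\<integral>x. k (h, x) \<partial>lborel) \<partial>lborel)"
    by (rule lborel_pair.Fubini_integral[of "\<lambda>h x. k (h, x)"]) (simp add: k_int)
  moreover have "(\<integral>h. k (h, x) \<partial>lborel) = f (w + x) - f x" for x
  proof -
    have "continuous_on {0..1} (\<lambda>h. g (x + h *\<^sub>R w))"
      by (rule continuous_on_subset[OF g_line]) simp
    then have "(\<integral>h. indicator {0..1} h *\<^sub>R g (x + h *\<^sub>R w) \<partial>lborel) = f (x + 1 *\<^sub>R w) - f (x + 0 *\<^sub>R w)"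
      by (intro integral_FTC_Icc[where F = "\<lambda>h. f (x + h *\<^sub>R w)"]
          has_vector_derivative_at_within[OF deriv]) simp_all
    then show ?thesis by (simp add: k_def add.commute)
  qed
  moreover have "(\<integral>h. (\<integral>x. k (h, x) \<partial>lborel) \<partial>lborel) = (\<integral>x. g x \<partial>lborel)"
  proof -
    have "(\<lambda>h. \<integral>x. k (h, x) \<partial>lborel) = (\<lambda>h. indicator {0..1} h *\<^sub>R (\<integral>x. g x \<partial>lborel))"
      by (auto simp: k_def shift(1))
    then show ?thesis by simp
  qed
  moreover have "(\<integral>x. f (w + x) - f x \<partial>lborel) = 0"
    using lborel_integral_shift[OF f_meas, of w] f by simp
  ultimately show ?thesis by simp
qed

section \<open>Holomorphic dependence of exponential integrals on their parameter\<close>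

lemma norm_exp_minus_1_minus_id_le:
  "norm (exp z - 1 - z) \<le> (norm z)\<^sup>2 * exp (norm (z::complex))"
proof -
  have "norm (exp z - 1 - z) \<le> exp \<bar>Re z\<bar> * (norm z)\<^sup>2"
    using Taylor_exp[of z 1] by (simp add: algebra_simps power2_eq_square)
  also have "\<dots> \<le> exp (norm z) * (norm z)\<^sup>2"
    using abs_Re_le_cmod by (intro mult_right_mono) auto
  finally show ?thesis by (simp add: mult.commute)
qed

text \<open>The decay rate \<open>\<epsilon>\<close> at the single point \<open>s\<close> leaves a
  margin: moving the parameter by less than \<open>\<epsilon> / 4\<close> costs at most
  \<open>exp (\<epsilon> / 4 * X x)\<close>. The second-order remainder of the exponential is thus
  bounded by the squared distance times an integrable function, and the first-order term is the
  complex-linear derivative.\<close>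

lemma holomorphic_Cn_on_exp_transform:
  fixes G :: "real ^ 'n \<Rightarrow> complex"
  defines "pair \<equiv> (\<lambda>(s :: complex^'n) (x :: real^'n). \<Sum>i\<in>UNIV. s $ i * of_real (x $ i))"
  assumes U: "open U" and G: "G \<in> borel_measurable borel"
    and decay: "\<And>s. s \<in> U \<Longrightarrow>
      \<exists>\<epsilon>>0. \<exists>C. \<forall>x. norm (exp (pair s x) * G x) \<le> C * exp (- \<epsilon> * (\<Sum>i\<in>UNIV. \<bar>x $ i\<bar>))"
  shows "holomorphic_Cn_on (\<lambda>s. \<integral>x. exp (pair s x) * G x \<partial>lborel) U"
  unfolding holomorphic_Cn_on_def
proof (intro conjI ballI)
  show "open U" by fact
  fix s assume s: "s \<in> U"
  define X where "X = (\<lambda>x::real^'n. \<Sum>i\<in>UNIV. \<bar>x $ i\<bar>)"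
  define E where "E = (\<lambda>s x. exp (pair s x) * G x)"
  have X0: "X x \<ge> 0" for x by (simp add: X_def sum_nonneg)
  have Emeas: "E s \<in> borel_measurable borel" for s
    unfolding E_def pair_def
    by (intro borel_measurable_times G borel_measurable_continuous_onI continuous_intros)
  have pmeas: "pair v \<in> borel_measurable borel" for v
    unfolding pair_def by (intro borel_measurable_continuous_onI continuous_intros)
  have pair_le: "norm (pair v x) \<le> norm v * X x" for v x
  proof -
    have "norm (pair v x) \<le> (\<Sum>i\<in>UNIV. norm (v $ i) * \<bar>x $ i\<bar>)"
      unfolding pair_def by (rule order_trans[OF norm_sum]) (simp add: norm_mult)
    also have "\<dots> \<le> (\<Sum>i\<in>UNIV. norm v * \<bar>x $ i\<bar>)"
      by (intro sum_mono mult_right_mono Finite_Cartesian_Product.norm_nth_le) auto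
    finally show ?thesis by (simp add: X_def sum_distrib_left)
  qed
  have pair_add: "pair (a + b) x = pair a x + pair b x" for a b x
    by (simp add: pair_def algebra_simps sum.distrib)
  have pair_smult: "pair (c *s v) x = c * pair v x" for c v x
    by (simp add: pair_def algebra_simps sum_distrib_left)
  have pair_scaleR: "pair (c *\<^sub>R v) x = c *\<^sub>R pair v x" for c v x
    by (simp add: pair_def algebra_simps scaleR_sum_right)
  obtain \<epsilon> C where eps: "\<epsilon> > 0" and bd: "\<And>x. norm (E s x) \<le> C * exp (- \<epsilon> * X x)"
    using decay[OF s] unfolding E_def X_def by blast
  have C0: "C \<ge> 0" using bd[of 0] X0[of 0] norm_ge_zero[of "E s 0"]
    by (metis exp_gt_zero mult_neg_pos not_le order_trans)
  define w where "w = (\<lambda>x::real^'n. exp (- (\<epsilon> / 2) * X x))"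
  have w_int: "integrable lborel w" unfolding w_def X_def
    using integrable_exp_minus_l1[of "\<epsilon> / 2"] eps by simp
  have poly1: "X x * exp (- \<epsilon> * X x) \<le> 2 / \<epsilon> * w x" for x
  proof -
    have "\<epsilon> / 2 * X x \<le> exp (\<epsilon> / 2 * X x)"
      using exp_ge_add_one_self[of "\<epsilon> / 2 * X x"] by linarith
    then have "X x \<le> 2 / \<epsilon> * exp (\<epsilon> / 2 * X x)" using eps by (simp add: field_simps)
    then have "X x * exp (- \<epsilon> * X x) \<le> 2 / \<epsilon> * exp (\<epsilon> / 2 * X x) * exp (- \<epsilon> * X x)"
      by (rule mult_right_mono) simp
    also have "\<dots> = 2 / \<epsilon> * exp (\<epsilon> / 2 * X x + - \<epsilon> * X x)"
      by (simp only: exp_add mult.assoc)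
    also have "\<epsilon> / 2 * X x + - \<epsilon> * X x = - (\<epsilon> / 2) * X x" by (simp add: field_simps)
    finally show ?thesis by (simp add: w_def)
  qed
  \<comment> \<open>The rate \<open>\<epsilon>\<close> is shared out: a quarter pays for the moved
    parameter, a quarter for the square, and half remains in \<open>w\<close>. The constant 32 comes
    from \<open>t\<^sup>2 / 2 \<le> exp t\<close> at
    \<open>t = \<epsilon> / 4 * X x\<close>.\<close>
  have poly2: "(X x)\<^sup>2 * exp (\<epsilon> / 4 * X x) * exp (- \<epsilon> * X x) \<le> 32 / \<epsilon>\<^sup>2 * w x" for x
  proof -
    have "(\<epsilon> / 4 * X x)\<^sup>2 / 2 \<le> exp (\<epsilon> / 4 * X x)"
    proof -
      have nn: "0 \<le> \<epsilon> / 4 * X x" using eps X0 by simp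
      show ?thesis using exp_lower_Taylor_quadratic[OF nn] nn by linarith
    qed
    then have "(X x)\<^sup>2 \<le> 32 / \<epsilon>\<^sup>2 * exp (\<epsilon> / 4 * X x)"
      using eps by (simp add: field_simps power2_eq_square)
    then have "(X x)\<^sup>2 * (exp (\<epsilon> / 4 * X x) * exp (- \<epsilon> * X x))
        \<le> 32 / \<epsilon>\<^sup>2 * exp (\<epsilon> / 4 * X x) * (exp (\<epsilon> / 4 * X x) * exp (- \<epsilon> * X x))"
      by (rule mult_right_mono) simp
    also have "\<dots> = 32 / \<epsilon>\<^sup>2 * exp (\<epsilon> / 4 * X x + (\<epsilon> / 4 * X x + - \<epsilon> * X x))"
      by (simp only: exp_add mult.assoc)
    also have "\<epsilon> / 4 * X x + (\<epsilon> / 4 * X x + - \<epsilon> * X x) = - (\<epsilon> / 2) * X x" by (simp add: field_simps)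
    finally show ?thesis by (simp add: w_def)
  qed
  have int_s: "integrable lborel (E s)"
  proof (rule Bochner_Integration.integrable_bound)
    show "integrable lborel (\<lambda>x. C * exp (- \<epsilon> * X x))"
      unfolding X_def by (rule integrable_mult_right[OF integrable_exp_minus_l1[OF eps]])
    show "E s \<in> borel_measurable lborel" using Emeas by simp
    show "AE x in lborel. norm (E s x) \<le> norm (C * exp (- \<epsilon> * X x))"
      using bd C0 by (intro AE_I2) (simp add: abs_mult)
  qed
  have int_v: "integrable lborel (\<lambda>x. pair v x * E s x)" for v
  proof (rule Bochner_Integration.integrable_bound)
    show "integrable lborel (\<lambda>x. norm v * C * (2 / \<epsilon>) * w x)" using w_int by simp
    show "(\<lambda>x. pair v x * E s x) \<in> borel_measurable lborel"
      using Emeas pmeas by (simp add: borel_measurable_times)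
    have "norm (pair v x * E s x) \<le> norm v * C * (2 / \<epsilon>) * w x" for x
    proof -
      have "norm (pair v x * E s x) \<le> (norm v * X x) * (C * exp (- \<epsilon> * X x))"
        unfolding norm_mult using pair_le bd X0 by (intro mult_mono) auto
      also have "\<dots> = norm v * C * (X x * exp (- \<epsilon> * X x))" by (simp only: mult_ac)
      also have "\<dots> \<le> norm v * C * (2 / \<epsilon> * w x)"
        using poly1 C0 by (intro mult_left_mono) auto
      finally show ?thesis by (simp only: mult.assoc)
    qed
    from order_trans[OF this abs_ge_self]
    show "AE x in lborel. norm (pair v x * E s x) \<le> norm (norm v * C * (2 / \<epsilon>) * w x)"
      unfolding real_norm_def by (intro AE_I2)
  qed
  define D where "D = (\<lambda>v. \<integral>x. pair v x * E s x \<partial>lborel)"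
  have D_smult: "D (c *s v) = c * D v" for c v
    unfolding D_def pair_smult by (simp add: mult.assoc)
  have "linear D"
  proof (rule linearI)
    show "D (a + b) = D a + D b" for a b
      unfolding D_def pair_add using int_v by (simp add: distrib_right)
    show "D (c *\<^sub>R v) = c *\<^sub>R D v" for c v
      unfolding D_def pair_scaleR by simp
  qed
  then have D_lin: "bounded_linear D" by (simp add: linear_conv_bounded_linear)
  define K where "K = C * (32 / \<epsilon>\<^sup>2) * (\<integral>x. w x \<partial>lborel)"
  have est: "norm ((\<integral>x. E y x \<partial>lborel) - (\<integral>x. E s x \<partial>lborel) - D (y - s)) \<le> K * (norm (y - s))\<^sup>2"
    if y: "dist y s < \<epsilon> / 4" for y
  proof -
    define h where "h = y - s"
    have h: "norm h \<le> \<epsilon> / 4" using y by (simp add: h_def dist_norm)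
    have E_y: "E y x = E s x * exp (pair h x)" for x
    proof -
      have "pair y x = pair s x + pair h x" by (simp add: h_def flip: pair_add)
      then show ?thesis by (simp add: E_def exp_add)
    qed
    define R where "R = (\<lambda>x. E s x * (exp (pair h x) - 1 - pair h x))"
    have R_le: "norm (R x) \<le> (norm h)\<^sup>2 * C * (32 / \<epsilon>\<^sup>2) * w x" for x
    proof -
      have le1: "norm (pair h x) \<le> norm h * X x" by (rule pair_le)
      have le2: "norm (pair h x) \<le> \<epsilon> / 4 * X x"
        using le1 mult_right_mono[OF h X0[of x]] by linarith
      have "norm (exp (pair h x) - 1 - pair h x) \<le> (norm (pair h x))\<^sup>2 * exp (norm (pair h x))"
        by (rule norm_exp_minus_1_minus_id_le)
      also have "\<dots> \<le> (norm h * X x)\<^sup>2 * exp (\<epsilon> / 4 * X x)"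
        using le1 le2 by (intro mult_mono power_mono) auto
      finally have "norm (R x) \<le> (C * exp (- \<epsilon> * X x)) * ((norm h * X x)\<^sup>2 * exp (\<epsilon> / 4 * X x))"
        unfolding R_def norm_mult using bd C0 by (intro mult_mono) auto
      also have "\<dots> = (norm h)\<^sup>2 * C * ((X x)\<^sup>2 * exp (\<epsilon> / 4 * X x) * exp (- \<epsilon> * X x))"
        by (simp only: power_mult_distrib mult_ac)
      also have "\<dots> \<le> (norm h)\<^sup>2 * C * (32 / \<epsilon>\<^sup>2 * w x)"
        using poly2 C0 by (intro mult_left_mono) auto
      finally show ?thesis by (simp only: mult.assoc)
    qed
    have R_int: "integrable lborel R"
    proof (rule Bochner_Integration.integrable_bound)
      show "integrable lborel (\<lambda>x. (norm h)\<^sup>2 * C * (32 / \<epsilon>\<^sup>2) * w x)" using w_int by simp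
      have "(\<lambda>x. exp (pair h x)) \<in> borel_measurable borel"
        unfolding pair_def by (intro borel_measurable_continuous_onI continuous_intros)
      then show "R \<in> borel_measurable lborel" unfolding R_def
        using Emeas pmeas by (simp add: borel_measurable_times borel_measurable_diff)
      show "AE x in lborel. norm (R x) \<le> norm ((norm h)\<^sup>2 * C * (32 / \<epsilon>\<^sup>2) * w x)"
        unfolding real_norm_def by (intro AE_I2) (rule order_trans[OF R_le abs_ge_self])
    qed
    have "E y = (\<lambda>x. R x + (E s x + pair h x * E s x))"
      by (rule ext) (simp add: E_y R_def algebra_simps)
    then have "(\<integral>x. E y x \<partial>lborel) = (\<integral>x. R x \<partial>lborel) + ((\<integral>x. E s x \<partial>lborel) + D h)"
      using R_int int_s int_v[of h] by (simp add: D_def)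
    then have "norm ((\<integral>x. E y x \<partial>lborel) - (\<integral>x. E s x \<partial>lborel) - D h) = norm (\<integral>x. R x \<partial>lborel)"
      by simp
    also have "\<dots> \<le> (\<integral>x. norm (R x) \<partial>lborel)"
      by (rule Bochner_Integration.integral_norm_bound)
    also have "\<dots> \<le> (\<integral>x. (norm h)\<^sup>2 * C * (32 / \<epsilon>\<^sup>2) * w x \<partial>lborel)"
      using R_int w_int R_le by (intro integral_mono integrable_norm integrable_mult_right) auto
    also have "\<dots> = K * (norm h)\<^sup>2" by (simp add: K_def)
    finally show ?thesis by (simp add: h_def)
  qed
  have "((\<lambda>s. \<integral>x. E s x \<partial>lborel) has_derivative D) (at s)"
  proof (rule has_derivativeI_sandwich[where H = "\<lambda>y. K * norm (y - s)"])
    show "\<epsilon> / 4 > 0" using eps by simp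
    show "bounded_linear D" by (rule D_lin)
    show "((\<lambda>y. K * norm (y - s)) \<longlongrightarrow> 0) (at s)"
      by (auto intro!: tendsto_eq_intros)
    fix y assume "y \<noteq> s" "dist y s < \<epsilon> / 4"
    then show "norm ((\<integral>x. E y x \<partial>lborel) - (\<integral>x. E s x \<partial>lborel) - D (y - s)) / norm (y - s)
        \<le> K * norm (y - s)"
      using est[of y] by (simp add: divide_le_eq power2_eq_square mult.assoc)
  qed
  then show "\<exists>f'. ((\<lambda>s. \<integral>x. exp (pair s x) * G x \<partial>lborel) has_derivative f') (at s) \<and>
      (\<forall>c v. f' (c *s v) = c * f' v)"
    using D_smult unfolding E_def by blast
qed

section \<open>The function \<open>w / (exp w - 1)\<close> and its derivatives\<close>

text \<open>The generating function of the Bernoulli numbers. Multiplying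
  \<open>1 / (exp w - 1)\<close> by \<open>w\<close> removes its pole at 0, so that all derivatives
  stay bounded near 0 and the singular part is a pure inverse power.\<close>

definition todd :: "complex \<Rightarrow> complex" where
  "todd w = (if w = 0 then 1 else w / (exp w - 1))"

definition todd_strip :: "complex set" where
  "todd_strip = {w. \<bar>Im w\<bar> < 2 * pi}"

lemma open_todd_strip: "open todd_strip"
  unfolding todd_strip_def by (intro open_Collect_less continuous_intros)

lemma exp_neq_1_todd_strip: "w \<in> todd_strip \<Longrightarrow> w \<noteq> 0 \<Longrightarrow> exp w \<noteq> 1"
proof
  assume w: "w \<in> todd_strip" "w \<noteq> 0" "exp w = 1"
  then obtain n :: int where n: "Re w = 0" "Im w = of_int (2 * n) * pi"
    unfolding exp_eq_1 by blast
  have "\<bar>of_int (2 * n)\<bar> * pi < 2 * pi"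
    using w(1) n(2) unfolding todd_strip_def by (simp add: abs_mult)
  then have "\<bar>of_int (2 * n)\<bar> < (2::real)" by simp
  then have "n = 0" by linarith
  then show False using n w(2) by (simp add: complex_eq_iff)
qed

lemma holomorphic_on_todd: "todd holomorphic_on todd_strip"
proof -
  define g where "g = (\<lambda>z::complex. if z = 0 then deriv exp 0 else (exp z - exp 0) / (z - 0))"
  have "g holomorphic_on todd_strip" unfolding g_def
    by (intro pole_lemma_open holomorphic_on_exp open_todd_strip)
  moreover have "g w \<noteq> 0" if "w \<in> todd_strip" for w
    using exp_neq_1_todd_strip[OF that] by (simp add: g_def DERIV_imp_deriv[OF DERIV_exp])
  ultimately have "(\<lambda>w. 1 / g w) holomorphic_on todd_strip"
    by (intro holomorphic_intros) auto
  moreover have "1 / g w = todd w" for w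
    by (simp add: g_def todd_def DERIV_imp_deriv[OF DERIV_exp])
  ultimately show ?thesis by simp
qed

text \<open>The region has room for unit circles around positive reals, as Cauchy's inequality will
  require. Decay at half the rate is claimed because the linear numerator \<open>w\<close> rules out
  the full rate.\<close>

lemma norm_todd_le: "\<exists>C. \<forall>w. Re w \<ge> - 1 \<and> \<bar>Im w\<bar> \<le> 1 \<longrightarrow> norm (todd w) \<le> C * exp (- Re w / 2)"
proof -
  let ?K = "cbox (Complex (- 1) (- 1)) (Complex 1 1)"
  have sub: "w \<in> todd_strip" if "\<bar>Im w\<bar> \<le> 1" for w
    using that pi_gt3 by (simp add: todd_strip_def)
  have "?K \<subseteq> todd_strip" by (auto simp: in_cbox_complex_iff intro!: sub)
  then have "continuous_on ?K todd"
    using holomorphic_on_imp_continuous_on[OF holomorphic_on_todd] continuous_on_subset by blast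
  then have "bounded (todd ` ?K)"
    using compact_continuous_image compact_cbox compact_imp_bounded by blast
  then obtain B where B: "\<And>w. w \<in> ?K \<Longrightarrow> norm (todd w) \<le> B" "B > 0"
    using bounded_pos[of "todd ` ?K"] by auto
  have "norm (todd w) \<le> (4 + B * exp (1 / 2)) * exp (- Re w / 2)"
    if w: "Re w \<ge> - 1" "\<bar>Im w\<bar> \<le> 1" for w
  proof (cases "Re w \<le> 1")
    case True
    have "norm (todd w) \<le> B * 1"
      using B(1)[of w] w True by (simp add: in_cbox_complex_iff abs_le_iff)
    also have "\<dots> \<le> B * (exp (1 / 2) * exp (- Re w / 2))"
      using B(2) True by (intro mult_left_mono) (auto simp flip: exp_add)
    also have "\<dots> \<le> (4 + B * exp (1 / 2)) * exp (- Re w / 2)"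
      by (simp add: algebra_simps)
    finally show ?thesis .
  next
    case False
    define x where "x = Re w"
    have x: "x > 1" using False by (simp add: x_def)
    have e: "exp x \<ge> 2" using exp_ge_add_one_self[of x] x by linarith
    have n1: "norm w \<le> x + 1" using cmod_le[of w] x w by (simp add: x_def)
    have n2: "norm (exp w - 1) \<ge> exp x / 2"
      using norm_triangle_ineq2[of "exp w" 1] e by (simp add: x_def)
    have "norm (todd w) = norm w / norm (exp w - 1)"
      using False by (auto simp: todd_def norm_divide)
    also have "\<dots> \<le> (x + 1) / (exp x / 2)"
      using n1 n2 x e by (intro frac_le) auto
    also have "\<dots> \<le> (4 * exp (x / 2)) / exp x"
    proof -
      have "x / 2 + 1 \<le> exp (x / 2)" using exp_ge_add_one_self[of "x / 2"] by linarith
      from mult_left_mono[OF this, of 4] x have "(x + 1) * 2 \<le> 4 * exp (x / 2)" by simp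
      then have "(x + 1) * 2 / exp x \<le> 4 * exp (x / 2) / exp x" by (intro divide_right_mono) auto
      then show ?thesis by simp
    qed
    also have "\<dots> = 4 * exp (x / 2 - x)" by (simp only: exp_diff times_divide_eq_right)
    also have "x / 2 - x = - x / 2" by (simp add: field_simps)
    also have "4 * exp (- x / 2) \<le> (4 + B * exp (1 / 2)) * exp (- x / 2)"
      using B(2) by (intro mult_right_mono) auto
    finally show ?thesis by (simp add: x_def)
  qed
  then show ?thesis by blast
qed

definition todd_deriv :: "nat \<Rightarrow> complex \<Rightarrow> complex" where
  "todd_deriv k = (deriv ^^ k) todd"

lemma of_real_in_todd_strip: "of_real u \<in> todd_strip"
  by (simp add: todd_strip_def)

lemma todd_deriv_has_field_derivative:
  "w \<in> todd_strip \<Longrightarrow> (todd_deriv k has_field_derivative todd_deriv (Suc k) w) (at w)"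
  unfolding todd_deriv_def
  using holomorphic_derivI[OF holomorphic_higher_deriv[OF holomorphic_on_todd open_todd_strip, of k]
      open_todd_strip, of w UNIV]
  by simp

lemma norm_todd_deriv_le:
  "\<exists>C>0. \<forall>u>0. norm (todd_deriv k (of_real u)) \<le> C * exp (- u / 2)"
proof -
  obtain C where C: "\<And>w. Re w \<ge> - 1 \<Longrightarrow> \<bar>Im w\<bar> \<le> 1 \<Longrightarrow> norm (todd w) \<le> C * exp (- Re w / 2)"
    using norm_todd_le by blast
  have C0: "C \<ge> 0"
    using order_trans[OF norm_ge_zero C[of 0]] by simp
  \<comment> \<open>Cauchy's inequality on the unit circle around \<open>u\<close>: moving the real
    part by at most 1 costs \<open>exp (1 / 2)\<close>. The summand 1 makes the constant strictly
    positive, as \<open>C\<close> is only known to be nonnegative.\<close>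
  have "norm (todd_deriv k (of_real u)) \<le> (fact k * C * exp (1 / 2) + 1) * exp (- u / 2)"
    if u: "u > 0" for u
  proof -
    have sub: "cball (of_real u) 1 \<subseteq> todd_strip"
    proof
      fix w assume "w \<in> cball (complex_of_real u) 1"
      then have "norm (w - of_real u) \<le> 1" by (simp add: dist_norm norm_minus_commute)
      then have "\<bar>Im w\<bar> \<le> 1" using abs_Im_le_cmod[of "w - of_real u"] by simp
      then show "w \<in> todd_strip" using pi_gt3 by (simp add: todd_strip_def)
    qed
    have "norm ((deriv ^^ k) todd (of_real u)) \<le> fact k * (C * exp (1 / 2) * exp (- u / 2)) / 1 ^ k"
    proof (rule Cauchy_inequality)
      show "todd holomorphic_on ball (of_real u) 1"
        using holomorphic_on_subset[OF holomorphic_on_todd] sub ball_subset_cball by blast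
      show "continuous_on (cball (of_real u) 1) todd"
        using holomorphic_on_imp_continuous_on[OF holomorphic_on_subset[OF holomorphic_on_todd sub]] .
      fix w assume "norm (complex_of_real u - w) = 1"
      then have n: "norm (w - of_real u) = 1" by (simp add: norm_minus_commute)
      have r: "\<bar>Re w - u\<bar> \<le> 1" "\<bar>Im w\<bar> \<le> 1"
        using abs_Re_le_cmod[of "w - of_real u"] abs_Im_le_cmod[of "w - of_real u"] n by auto
      have "norm (todd w) \<le> C * exp (- Re w / 2)" using r u by (intro C) auto
      also have "\<dots> \<le> C * exp (1 / 2 + - u / 2)"
        using C0 r by (intro mult_left_mono) auto
      finally show "norm (todd w) \<le> C * exp (1 / 2) * exp (- u / 2)"
        by (simp only: exp_add mult.assoc)
    qed simp
    also have "\<dots> \<le> (fact k * C * exp (1 / 2) + 1) * exp (- u / 2)"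
      by (simp add: algebra_simps)
    finally show ?thesis by (simp add: todd_deriv_def)
  qed
  moreover have "fact k * C * exp (1 / 2) + 1 > 0"
    using C0 by (intro add_nonneg_pos) auto
  ultimately show ?thesis by blast
qed

section \<open>The Mellin kernel\<close>

definition lin_form :: "real ^ 'r ^ 'n \<Rightarrow> 'r \<Rightarrow> real ^ 'n \<Rightarrow> real" where
  "lin_form A j x = (\<Sum>i\<in>UNIV. A $ i $ j * exp (x $ i))"

definition cols_within :: "real ^ 'r ^ 'n \<Rightarrow> 'n set \<Rightarrow> 'r set" where
  "cols_within A I = {j. {i. A $ i $ j \<noteq> 0} \<subseteq> I}"

text \<open>\<open>\<Sum>\<^sub>i\<^sub>\<in>\<^sub>I s\<^sub>i + weight A I v z\<close> is the degree of homogeneity, as \<open>x\<^sub>i \<rightarrow> -\<infinity>\<close> for \<open>i \<in> I\<close>, of the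
  integrand \<open>exp (\<Sum>\<^sub>i (s\<^sub>i + v\<^sub>i) x\<^sub>i) \<Prod>\<^sub>j lin_form A j x ^ (- z\<^sub>j)\<close>.\<close>

definition weight :: "real ^ 'r ^ 'n \<Rightarrow> 'n set \<Rightarrow> ('n \<Rightarrow> nat) \<Rightarrow> ('r \<Rightarrow> nat) \<Rightarrow> int" where
  "weight A I v z = int (\<Sum>i\<in>I. v i) - int (\<Sum>j\<in>cols_within A I. z j)"

definition cpair :: "complex ^ 'n \<Rightarrow> real ^ 'n \<Rightarrow> complex" where
  "cpair s x = (\<Sum>i\<in>UNIV. s $ i * of_real (x $ i))"

definition mellin_factor :: "nat \<Rightarrow> nat \<Rightarrow> complex \<Rightarrow> complex" where
  "mellin_factor z k w = inverse w ^ z * todd_deriv k w"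

text \<open>The three exponent families make the kernels closed under differentiation:
  \<open>v\<close> counts factors \<open>exp (x $ i)\<close>, \<open>z\<close> inverse powers of the
  forms and \<open>k\<close> derivatives of \<open>todd\<close>.\<close>

definition mellin_kernel ::
  "real ^ 'r ^ 'n \<Rightarrow> ('n \<Rightarrow> nat) \<Rightarrow> ('r \<Rightarrow> nat) \<Rightarrow> ('r \<Rightarrow> nat) \<Rightarrow> real ^ 'n \<Rightarrow> complex" where
  "mellin_kernel A v z k x = exp (of_real (\<Sum>i\<in>UNIV. real (v i) * x $ i)) *
     (\<Prod>j\<in>UNIV. mellin_factor (z j) (k j) (of_real (lin_form A j x)))"

text \<open>The degree of the integrand must have positive real part along each set of coordinates
  tending to \<open>-\<infinity>\<close>. Coordinates tending to \<open>\<infinity>\<close> impose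
  nothing when \<open>A\<close> is in \<open>Sigma_nonneg\<close>: each occurs in some form, and the
  todd derivatives decay exponentially in the forms.\<close>

definition conv_region :: "real ^ 'r ^ 'n \<Rightarrow> ('n \<Rightarrow> nat) \<Rightarrow> ('r \<Rightarrow> nat) \<Rightarrow> (complex ^ 'n) set" where
  "conv_region A v z = {s. \<forall>I. I \<noteq> {} \<longrightarrow> (\<Sum>i\<in>I. Re (s $ i)) + of_int (weight A I v z) > 0}"

lemma open_conv_region: "open (conv_region A v z)"
proof -
  have "conv_region A v z =
      (\<Inter>I\<in>{I. I \<noteq> {}}. {s. (\<Sum>i\<in>I. Re (s $ i)) + of_int (weight A I v z) > 0})"
    by (auto simp: conv_region_def)
  also have "open \<dots>"
    by (intro open_INT ballI open_Collect_less continuous_intros) simp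
  finally show ?thesis .
qed

section \<open>Exponential decay of the Mellin kernel\<close>

lemma Sigma_nonnegD:
  fixes A :: "real ^ 'r ^ 'n"
  assumes "A \<in> Sigma_nonneg"
  shows "A $ i $ j \<ge> 0" "\<exists>j. A $ i $ j > 0" "\<exists>i. A $ i $ j > 0"
  using assms unfolding Sigma_nonneg_def by auto

lemma lin_form_pos:
  fixes A :: "real ^ 'r ^ 'n"
  assumes "A \<in> Sigma_nonneg"
  shows "lin_form A j x > 0"
proof -
  obtain i where "A $ i $ j > 0" using Sigma_nonnegD(3)[OF assms] by blast
  then show ?thesis unfolding lin_form_def
    using Sigma_nonnegD(1)[OF assms] by (intro sum_pos2[of _ i]) auto
qed

text \<open>Peeling off level sets: \<open>y\<close> is a positive combination of indicators of its superlevel sets, on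
  which the inequality holds by assumption.\<close>

lemma superlevel_inequality:
  fixes \<epsilon> :: real and \<sigma> y :: "'n::finite \<Rightarrow> real" and z :: "'r::finite \<Rightarrow> nat" and S :: "'r \<Rightarrow> 'n set"
  assumes S: "\<And>j. S j \<noteq> {}" and y: "\<And>i. y i \<ge> 0"
    and pos: "\<And>I. I \<noteq> {} \<Longrightarrow> \<epsilon> * card I \<le> (\<Sum>i\<in>I. \<sigma> i) - (\<Sum>j | S j \<subseteq> I. real (z j))"
  shows "\<epsilon> * (\<Sum>i\<in>UNIV. y i) \<le> (\<Sum>i\<in>UNIV. \<sigma> i * y i) - (\<Sum>j\<in>UNIV. real (z j) * Min (y ` S j))"
  using y
proof (induction "card {i. y i > 0}" arbitrary: y rule: less_induct)
  case less
  define I where "I = {i. y i > 0}"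
  have out: "y i = 0" if "i \<notin> I" for i using that less.prems[of i] by (simp add: I_def)
  show ?case
  proof (cases "I = {}")
    case True
    then have "y = (\<lambda>i. 0)" using out by auto
    then show ?thesis using S by (simp add: image_constant_conv)
  next
    case False
    \<comment> \<open>Removing the lowest positive level \<open>h\<close> from all of
      \<open>I\<close> kills at least one coordinate, so the induction proceeds, and the removed
      layer is \<open>h\<close> times an indicator function.\<close>
    define h where "h = Min (y ` I)"
    have h_in: "h \<in> y ` I" unfolding h_def using False by (intro Min_in) auto
    then obtain i0 where i0: "i0 \<in> I" "h = y i0" by blast
    have h0: "h > 0" using i0 by (simp add: I_def)
    have h_le: "h \<le> y i" if "i \<in> I" for i unfolding h_def using that by (intro Min_le) auto
    define y' where "y' = (\<lambda>i. y i - (if i \<in> I then h else 0))"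
    have y'0: "y' i \<ge> 0" for i using h_le less.prems by (auto simp: y'_def)
    have "{i. y' i > 0} \<subset> {i. y i > 0}"
    proof
      show "{i. y' i > 0} \<subseteq> {i. y i > 0}" using h0 by (auto simp: y'_def split: if_splits)
      show "{i. y' i > 0} \<noteq> {i. y i > 0}" using i0 by (auto simp: y'_def I_def set_eq_iff)
    qed
    then have "card {i. y' i > 0} < card {i. y i > 0}" by (intro psubset_card_mono) auto
    from less.hyps[OF this y'0]
    have IH: "\<epsilon> * (\<Sum>i\<in>UNIV. y' i)
        \<le> (\<Sum>i\<in>UNIV. \<sigma> i * y' i) - (\<Sum>j\<in>UNIV. real (z j) * Min (y' ` S j))" .
    have sum_if: "(\<Sum>i\<in>UNIV. c i * (if i \<in> I then h else 0)) = h * (\<Sum>i\<in>I. c i)" for c :: "'n \<Rightarrow> real"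
      by (simp add: if_distrib[of "\<lambda>t. _ * t"] sum.If_cases sum_distrib_left mult.commute)
    have e1: "(\<Sum>i\<in>UNIV. y i) = (\<Sum>i\<in>UNIV. y' i) + h * card I"
      using sum_if[of "\<lambda>i. 1"] by (simp add: y'_def sum_subtractf)
    have e2: "(\<Sum>i\<in>UNIV. \<sigma> i * y i) = (\<Sum>i\<in>UNIV. \<sigma> i * y' i) + h * (\<Sum>i\<in>I. \<sigma> i)"
      using sum_if[of \<sigma>] by (simp add: y'_def sum_subtractf right_diff_distrib)
    \<comment> \<open>Only the \<open>S j\<close> inside \<open>I\<close> see their minimum drop by
      \<open>h\<close>; any other \<open>S j\<close> contains a point outside \<open>I\<close>,
      where \<open>y\<close> vanishes, so its minimum is already 0.\<close>
    have m: "Min (y ` S j) \<le> Min (y' ` S j) + (if S j \<subseteq> I then h else 0)" for j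
    proof (cases "S j \<subseteq> I")
      case True
      have "Min (y' ` S j) \<in> y' ` S j" using S by (intro Min_in) auto
      then obtain i where i: "i \<in> S j" "Min (y' ` S j) = y' i" by blast
      have "Min (y ` S j) \<le> y i" using i by (intro Min_le) auto
      also have "y i = y' i + h" using True i by (auto simp: y'_def)
      finally show ?thesis using i True by simp
    next
      case False
      then obtain i where i: "i \<in> S j" "i \<notin> I" by blast
      have "Min (y ` S j) \<le> y i" using i by (intro Min_le) auto
      moreover have "Min (y' ` S j) \<in> y' ` S j" using S by (intro Min_in) auto
      then have "Min (y' ` S j) \<ge> 0" using y'0 by auto
      ultimately show ?thesis using out[OF i(2)] False by simp
    qed
    have "(\<Sum>j\<in>UNIV. real (z j) * Min (y ` S j))
        \<le> (\<Sum>j\<in>UNIV. real (z j) * Min (y' ` S j) + real (z j) * (if S j \<subseteq> I then h else 0))"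
      unfolding distrib_left[symmetric] by (intro sum_mono mult_left_mono m) simp
    also have "\<dots> = (\<Sum>j\<in>UNIV. real (z j) * Min (y' ` S j)) + h * (\<Sum>j | S j \<subseteq> I. real (z j))"
      by (simp add: sum.distrib if_distrib[of "\<lambda>t. _ * t"] sum.If_cases sum_distrib_left mult.commute)
    finally have e3: "(\<Sum>j\<in>UNIV. real (z j) * Min (y ` S j))
        \<le> (\<Sum>j\<in>UNIV. real (z j) * Min (y' ` S j)) + h * (\<Sum>j | S j \<subseteq> I. real (z j))" .
    have "h * (\<epsilon> * card I) \<le> h * ((\<Sum>i\<in>I. \<sigma> i) - (\<Sum>j | S j \<subseteq> I. real (z j)))"
      using pos[OF False] h0 by (intro mult_left_mono) auto
    then show ?thesis using IH e3 unfolding e1 e2 by (simp add: algebra_simps)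
  qed
qed

lemma linear_le_exp:
  assumes "(c::real) > 0" "K \<ge> 0" "p \<ge> 0"
  shows "K * p \<le> c * exp p + K\<^sup>2 / (2 * c)"
proof -
  have "K * p \<le> c * (p\<^sup>2 / 2) + K\<^sup>2 / (2 * c)"
  proof -
    have "0 \<le> (c * p - K)\<^sup>2 / (2 * c)" using assms by simp
    also have "\<dots> = c * (p\<^sup>2 / 2) + K\<^sup>2 / (2 * c) - K * p"
      using assms by (simp add: field_simps power2_eq_square)
    finally show ?thesis by simp
  qed
  also have "c * (p\<^sup>2 / 2) \<le> c * exp p"
    using exp_lower_Taylor_quadratic[OF assms(3)] assms by (intro mult_left_mono) auto
  finally show ?thesis by simp
qed

text \<open>Split each coordinate as \<open>x $ i = p i - y i\<close> with nonnegative parts. A form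
  is at least \<open>c * exp (- m j)\<close>, \<open>m j\<close> being the minimum of
  \<open>y\<close> on its support, so its inverse powers cost
  \<open>exp (\<Sum>j. z j * m j)\<close>; \<open>superlevel_inequality\<close> shows that the
  linear exponent outweighs this. For the \<open>p\<close> part, \<open>exp (- l j / 2)\<close>
  beats every linear exponent.\<close>

lemma mellin_kernel_decay:
  fixes A :: "real ^ 'r ^ 'n"
  assumes A: "A \<in> Sigma_nonneg" and s: "s \<in> conv_region A v z"
  shows "\<exists>\<epsilon>>0. \<exists>C. \<forall>x. norm (exp (cpair s x) * mellin_kernel A v z k x)
           \<le> C * exp (- \<epsilon> * (\<Sum>i\<in>UNIV. \<bar>x $ i\<bar>))"
proof -
  define S where "S = (\<lambda>j. {i. A $ i $ j \<noteq> 0})"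
  have S: "S j \<noteq> {}" for j using Sigma_nonnegD(3)[OF A, of j] unfolding S_def by force
  define \<sigma> where "\<sigma> = (\<lambda>i. Re (s $ i) + real (v i))"
  define val where "val = (\<lambda>I. (\<Sum>i\<in>I. \<sigma> i) - (\<Sum>j | S j \<subseteq> I. real (z j)))"
  have val_pos: "val I > 0" if "I \<noteq> {}" for I
  proof -
    have "val I = (\<Sum>i\<in>I. Re (s $ i)) + of_int (weight A I v z)"
      unfolding val_def \<sigma>_def weight_def cols_within_def S_def by (simp add: sum.distrib)
    then show ?thesis using s that unfolding conv_region_def by simp
  qed
  define d where "d = Min (val ` {I. I \<noteq> {}})"
  have ne: "{I :: 'n set. I \<noteq> {}} \<noteq> {}" by auto
  have d_pos: "d > 0" unfolding d_def using ne val_pos by (subst Min_gr_iff) auto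
  have d_le: "d \<le> val I" if "I \<noteq> {}" for I unfolding d_def using that by (intro Min_le) auto
  \<comment> \<open>Dividing the least slack \<open>d\<close> by the dimension gives
    \<open>\<epsilon> * card I \<le> val I\<close> for all nonempty \<open>I\<close> at
    once.\<close>
  define \<epsilon> where "\<epsilon> = d / CARD('n)"
  have eps: "\<epsilon> > 0" using d_pos by (simp add: \<epsilon>_def)
  have eps_le: "\<epsilon> * card I \<le> val I" if "I \<noteq> {}" for I
  proof -
    have "\<epsilon> * card I \<le> \<epsilon> * CARD('n)"
      using eps by (intro mult_left_mono) (auto intro: card_mono)
    also have "\<dots> = d" by (simp add: \<epsilon>_def)
    finally show ?thesis using d_le[OF that] by linarith
  qed
  define P where "P = {A $ i $ j | i j. A $ i $ j > 0}"
  have "P = (\<lambda>(i, j). A $ i $ j) ` {(i, j). A $ i $ j > 0}" by (auto simp: P_def)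
  then have P_fin: "finite P" by simp
  have P_ne: "P \<noteq> {}" using Sigma_nonnegD(2)[OF A, of undefined] by (auto simp: P_def)
  define c where "c = Min P"
  have c_pos: "c > 0" unfolding c_def using P_fin P_ne by (subst Min_gr_iff) (auto simp: P_def)
  have c_le: "c \<le> A $ i $ j" if "A $ i $ j > 0" for i j
    unfolding c_def using P_fin that by (intro Min_le) (auto simp: P_def)
  obtain B where B: "\<And>j. B j > 0"
    "\<And>j u. u > 0 \<Longrightarrow> norm (todd_deriv (k j) (of_real u)) \<le> B j * exp (- u / 2)"
    using norm_todd_deriv_le[of "k _"] by metis
  \<comment> \<open>\<open>K i\<close> is the slope to be beaten including the desired rate
    \<open>\<epsilon>\<close>. In \<open>C1\<close>, the square comes from
    \<open>linear_le_exp\<close> with constant \<open>c / 2\<close>, and the summand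
    \<open>c / 2\<close> from \<open>exp (p i) \<le> exp (x $ i) + 1\<close>.\<close>
  define K where "K = (\<lambda>i. \<bar>\<sigma> i\<bar> + \<epsilon>)"
  define C1 where "C1 = (\<lambda>i. c / 2 + (K i)\<^sup>2 / (2 * (c / 2)))"
  define C2 where "C2 = (\<Prod>j\<in>UNIV. B j * inverse c ^ z j)"
  have "norm (exp (cpair s x) * mellin_kernel A v z k x)
      \<le> C2 * exp (\<Sum>i\<in>UNIV. C1 i) * exp (- \<epsilon> * (\<Sum>i\<in>UNIV. \<bar>x $ i\<bar>))" for x
  proof -
    define y where "y = (\<lambda>i. max 0 (- (x $ i)))"
    define p where "p = (\<lambda>i. max 0 (x $ i))"
    define l where "l = (\<lambda>j. lin_form A j x)"
    define m where "m = (\<lambda>j. Min (y ` S j))"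
    have l_pos: "l j > 0" for j unfolding l_def by (rule lin_form_pos[OF A])
    have term_le: "A $ i $ j * exp (x $ i) \<le> l j" for i j
      unfolding l_def lin_form_def using Sigma_nonnegD(1)[OF A]
      by (intro member_le_sum) auto
    have l_ge: "l j \<ge> c * exp (- m j)" for j
    proof -
      have "m j \<in> y ` S j" unfolding m_def using S by (intro Min_in) auto
      then obtain i where i: "i \<in> S j" "m j = y i" by blast
      have "A $ i $ j > 0" using i(1) Sigma_nonnegD(1)[OF A, of i j] by (simp add: S_def)
      then have "c * exp (- m j) \<le> A $ i $ j * exp (x $ i)"
        using c_le c_pos i(2) by (intro mult_mono) (auto simp: y_def)
      then show ?thesis using term_le[of i j] by linarith
    qed
    have fac: "norm (mellin_factor (z j) (k j) (of_real (l j)))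
        \<le> (B j * inverse c ^ z j) * (exp (real (z j) * m j) * exp (- l j / 2))" for j
    proof -
      have "inverse (l j) \<le> inverse (c * exp (- m j))"
        using l_ge c_pos by (intro le_imp_inverse_le) auto
      then have "inverse (l j) ^ z j \<le> inverse (c * exp (- m j)) ^ z j"
        using l_pos[of j] by (intro power_mono) auto
      also have "\<dots> = inverse c ^ z j * exp (real (z j) * m j)"
        by (simp add: power_mult_distrib exp_minus exp_of_nat_mult)
      finally have "norm (mellin_factor (z j) (k j) (of_real (l j)))
          \<le> (inverse c ^ z j * exp (real (z j) * m j)) * (B j * exp (- l j / 2))"
        unfolding mellin_factor_def norm_mult using B(2)[OF l_pos, of j] l_pos[of j] c_pos
        by (intro mult_mono) (auto simp: norm_power norm_inverse)
      then show ?thesis by (simp only: mult_ac)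
    qed
    \<comment> \<open>Here the positive entry in every row matters: each \<open>exp (x $ i)\<close>
      appears in some form.\<close>
    have sum_l: "(\<Sum>j\<in>UNIV. l j) \<ge> (\<Sum>i\<in>UNIV. c * exp (x $ i))"
    proof -
      have "(\<Sum>j\<in>UNIV. l j) = (\<Sum>i\<in>UNIV. \<Sum>j\<in>UNIV. A $ i $ j * exp (x $ i))"
        unfolding l_def lin_form_def by (rule sum.swap)
      moreover have "c * exp (x $ i) \<le> (\<Sum>j\<in>UNIV. A $ i $ j * exp (x $ i))" for i
      proof -
        obtain j where j: "A $ i $ j > 0" using Sigma_nonnegD(2)[OF A] by blast
        have "c * exp (x $ i) \<le> A $ i $ j * exp (x $ i)" using c_le[OF j] by simp
        also have "\<dots> \<le> (\<Sum>j\<in>UNIV. A $ i $ j * exp (x $ i))"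
          using Sigma_nonnegD(1)[OF A] by (intro member_le_sum) auto
        finally show ?thesis .
      qed
      ultimately show ?thesis by (simp add: sum_mono)
    qed
    have one_d: "\<sigma> i * p i - c / 2 * exp (x $ i) \<le> C1 i - \<epsilon> * p i" for i
    proof -
      have "K i * p i \<le> c / 2 * exp (p i) + (K i)\<^sup>2 / (2 * (c / 2))"
        using c_pos eps by (intro linear_le_exp) (auto simp: K_def p_def)
      moreover have "exp (p i) \<le> exp (x $ i) + 1"
        unfolding p_def by (cases "x $ i \<ge> 0") (auto simp: max_def)
      then have "c / 2 * exp (p i) \<le> c / 2 * (exp (x $ i) + 1)"
        using c_pos by (intro mult_left_mono) auto
      moreover have "\<sigma> i * p i \<le> \<bar>\<sigma> i\<bar> * p i" by (intro mult_right_mono) (auto simp: p_def)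
      ultimately show ?thesis by (simp add: K_def C1_def algebra_simps)
    qed
    have layer: "\<epsilon> * (\<Sum>i\<in>UNIV. y i) \<le> (\<Sum>i\<in>UNIV. \<sigma> i * y i) - (\<Sum>j\<in>UNIV. real (z j) * m j)"
      unfolding m_def
      by (rule superlevel_inequality[of S y \<epsilon> \<sigma> z, OF S _ eps_le[unfolded val_def]]) (simp_all add: y_def)
    have x_eq: "x $ i = p i - y i" "\<bar>x $ i\<bar> = p i + y i" for i by (auto simp: p_def y_def)
    have "norm (exp (cpair s x) * mellin_kernel A v z k x)
        = exp (\<Sum>i\<in>UNIV. \<sigma> i * x $ i) * (\<Prod>j\<in>UNIV. norm (mellin_factor (z j) (k j) (of_real (l j))))"
    proof -
      have "norm (exp (cpair s x)) * norm (exp (complex_of_real (\<Sum>i\<in>UNIV. real (v i) * x $ i)))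
          = exp (\<Sum>i\<in>UNIV. \<sigma> i * x $ i)"
        by (simp add: cpair_def \<sigma>_def sum.distrib distrib_right flip: exp_add)
      then show ?thesis unfolding mellin_kernel_def norm_mult l_def
        by (simp add: prod_norm mult.assoc[symmetric])
    qed
    also have "\<dots> \<le> exp (\<Sum>i\<in>UNIV. \<sigma> i * x $ i) *
        (\<Prod>j\<in>UNIV. (B j * inverse c ^ z j) * (exp (real (z j) * m j) * exp (- l j / 2)))"
      using fac by (intro mult_left_mono prod_mono) auto
    also have "\<dots> = C2 * exp ((\<Sum>i\<in>UNIV. \<sigma> i * x $ i) +
        ((\<Sum>j\<in>UNIV. real (z j) * m j) - (\<Sum>j\<in>UNIV. l j) / 2))"
    proof -
      have "(\<Prod>j\<in>UNIV. exp (real (z j) * m j)) = exp (\<Sum>j\<in>UNIV. real (z j) * m j)"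
        by (rule exp_sum[symmetric]) simp
      moreover have "(\<Prod>j\<in>UNIV. exp (- l j / 2)) = exp (\<Sum>j\<in>UNIV. - l j / 2)"
        by (rule exp_sum[symmetric]) simp
      moreover have "(\<Sum>j\<in>UNIV. - l j / 2) = - ((\<Sum>j\<in>UNIV. l j) / 2)"
        by (simp only: minus_divide_left[symmetric] sum_negf sum_divide_distrib)
      ultimately show ?thesis
        by (simp only: prod.distrib C2_def exp_add diff_conv_add_uminus mult_ac)
    qed
    also have "\<dots> \<le> C2 * exp ((\<Sum>i\<in>UNIV. C1 i) - \<epsilon> * (\<Sum>i\<in>UNIV. \<bar>x $ i\<bar>))"
    proof (rule mult_left_mono)
      show "C2 \<ge> 0" unfolding C2_def using B(1) c_pos by (intro prod_nonneg) (auto intro!: less_imp_le)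
      have "(\<Sum>i\<in>UNIV. \<sigma> i * p i - c / 2 * exp (x $ i)) \<le> (\<Sum>i\<in>UNIV. C1 i - \<epsilon> * p i)"
        by (intro sum_mono one_d)
      then have "(\<Sum>i\<in>UNIV. \<sigma> i * p i) - (\<Sum>i\<in>UNIV. c * exp (x $ i)) / 2
          \<le> (\<Sum>i\<in>UNIV. C1 i) - \<epsilon> * (\<Sum>i\<in>UNIV. p i)"
        by (simp add: sum_subtractf sum_distrib_left sum_divide_distrib)
      moreover have "(\<Sum>i\<in>UNIV. \<sigma> i * x $ i) = (\<Sum>i\<in>UNIV. \<sigma> i * p i) - (\<Sum>i\<in>UNIV. \<sigma> i * y i)"
        unfolding x_eq(1) by (simp add: sum_subtractf right_diff_distrib)
      moreover have "\<epsilon> * (\<Sum>i\<in>UNIV. \<bar>x $ i\<bar>) = \<epsilon> * (\<Sum>i\<in>UNIV. p i) + \<epsilon> * (\<Sum>i\<in>UNIV. y i)"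
        unfolding x_eq(2) by (simp add: sum.distrib distrib_left)
      ultimately show "exp ((\<Sum>i\<in>UNIV. \<sigma> i * x $ i) +
          ((\<Sum>j\<in>UNIV. real (z j) * m j) - (\<Sum>j\<in>UNIV. l j) / 2))
        \<le> exp ((\<Sum>i\<in>UNIV. C1 i) - \<epsilon> * (\<Sum>i\<in>UNIV. \<bar>x $ i\<bar>))"
        using layer sum_l by (subst exp_le_cancel_iff) linarith
    qed
    also have "\<dots> = C2 * exp (\<Sum>i\<in>UNIV. C1 i) * exp (- \<epsilon> * (\<Sum>i\<in>UNIV. \<bar>x $ i\<bar>))"
      by (simp only: mult_minus_left diff_conv_add_uminus exp_add mult.assoc)
    finally show ?thesis .
  qed
  then show ?thesis using eps by blast
qed

section \<open>Integration by parts and continuation\<close>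

definition mellin_integrand ::
  "real ^ 'r ^ 'n \<Rightarrow> ('n \<Rightarrow> nat) \<Rightarrow> ('r \<Rightarrow> nat) \<Rightarrow> ('r \<Rightarrow> nat) \<Rightarrow> complex ^ 'n \<Rightarrow> real ^ 'n \<Rightarrow> complex" where
  "mellin_integrand A v z k s x = exp (cpair s x) * mellin_kernel A v z k x"

definition mellin_integral ::
  "real ^ 'r ^ 'n \<Rightarrow> ('n \<Rightarrow> nat) \<Rightarrow> ('r \<Rightarrow> nat) \<Rightarrow> ('r \<Rightarrow> nat) \<Rightarrow> complex ^ 'n \<Rightarrow> complex" where
  "mellin_integral A v z k s = (\<integral>x. mellin_integrand A v z k s x \<partial>lborel)"

lemma continuous_on_mellin_kernel:
  fixes A :: "real ^ 'r ^ 'n"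
  assumes A: "A \<in> Sigma_nonneg"
  shows "continuous_on UNIV (mellin_kernel A v z k)"
proof -
  have lin: "continuous_on UNIV (\<lambda>x. complex_of_real (lin_form A j x))" for j
    unfolding lin_form_def by (intro continuous_intros)
  have nz: "lin_form A j x \<noteq> 0" for j x
    using lin_form_pos[OF A, of j x] by simp
  have td: "continuous_on todd_strip (todd_deriv m)" for m
    by (intro continuous_at_imp_continuous_on ballI DERIV_isCont[OF todd_deriv_has_field_derivative])
  have "continuous_on UNIV (\<lambda>x. mellin_factor (z j) (k j) (of_real (lin_form A j x)))" for j
    unfolding mellin_factor_def
    by (intro continuous_on_mult continuous_on_power continuous_on_inverse lin
        continuous_on_compose2[OF td lin])
      (use nz of_real_in_todd_strip in auto)
  then show ?thesis unfolding mellin_kernel_def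
    by (intro continuous_on_mult continuous_on_prod) (auto intro!: continuous_intros)
qed

lemma continuous_on_mellin_integrand:
  fixes A :: "real ^ 'r ^ 'n"
  assumes "A \<in> Sigma_nonneg"
  shows "continuous_on UNIV (mellin_integrand A v z k s)"
  unfolding mellin_integrand_def cpair_def
  by (intro continuous_on_mult continuous_on_mellin_kernel[OF assms] continuous_intros)

lemma integrable_mellin_integrand:
  fixes A :: "real ^ 'r ^ 'n"
  assumes A: "A \<in> Sigma_nonneg" and s: "s \<in> conv_region A v z"
  shows "integrable lborel (mellin_integrand A v z k s)"
proof -
  obtain \<epsilon> C where eps: "\<epsilon> > 0" and le: "\<And>x. norm (mellin_integrand A v z k s x)
      \<le> C * exp (- \<epsilon> * (\<Sum>i\<in>UNIV. \<bar>x $ i\<bar>))"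
    using mellin_kernel_decay[OF assms] unfolding mellin_integrand_def by blast
  show ?thesis
  proof (rule Bochner_Integration.integrable_bound)
    show "integrable lborel (\<lambda>x::real^'n. C * exp (- \<epsilon> * (\<Sum>i\<in>UNIV. \<bar>x $ i\<bar>)))"
      by (rule integrable_mult_right[OF integrable_exp_minus_l1[OF eps]])
    show "mellin_integrand A v z k s \<in> borel_measurable lborel"
      using borel_measurable_continuous_onI[OF continuous_on_mellin_integrand[OF A]] by simp
    show "AE x in lborel. norm (mellin_integrand A v z k s x)
        \<le> norm (C * exp (- \<epsilon> * (\<Sum>i\<in>UNIV. \<bar>x $ i\<bar>)))"
      unfolding real_norm_def by (intro AE_I2) (rule order_trans[OF le abs_ge_self])
  qed
qed

lemma holomorphic_mellin_integral:
  fixes A :: "real ^ 'r ^ 'n"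
  assumes A: "A \<in> Sigma_nonneg"
  shows "holomorphic_Cn_on (mellin_integral A v z k) (conv_region A v z)"
  unfolding mellin_integral_def mellin_integrand_def cpair_def
  by (rule holomorphic_Cn_on_exp_transform[OF open_conv_region
      borel_measurable_continuous_onI[OF continuous_on_mellin_kernel[OF A]]])
    (rule mellin_kernel_decay[OF A, unfolded cpair_def])

lemma mellin_factor_has_field_derivative:
  assumes "u > 0"
  shows "(mellin_factor z k has_field_derivative
     mellin_factor z (Suc k) (of_real u) - of_nat z * mellin_factor (Suc z) k (of_real u))
     (at (of_real u))"
proof -
  have nz: "complex_of_real u \<noteq> 0" using assms by simp
  show ?thesis
    unfolding mellin_factor_def
    by (rule DERIV_cong, rule DERIV_mult, rule DERIV_power, rule DERIV_inverse[OF nz],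
        rule todd_deriv_has_field_derivative[OF of_real_in_todd_strip])
      (cases z, simp_all add: algebra_simps)
qed

text \<open>Differentiating the integrand in the direction \<open>\<one>\<^sub>I\<close> reproduces it up to the scalar
  \<open>\<Sum>\<^sub>i\<^sub>\<in>\<^sub>I s\<^sub>i + weight\<close> and terms whose parameters are shifted as follows: a triple \<open>(i, j, True)\<close>
  comes from differentiating the \<open>todd\<close> factor at \<open>j\<close>, and \<open>(i, j, False)\<close> from differentiating the
  inverse power of a form that is not homogeneous in the variables of \<open>I\<close>.\<close>

fun shift_coeff :: "real ^ 'r ^ 'n \<Rightarrow> 'n set \<Rightarrow> ('r \<Rightarrow> nat) \<Rightarrow> 'n \<times> 'r \<times> bool \<Rightarrow> complex" where
  "shift_coeff A I z (i, j, b) =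
     (if i \<in> I then
        if b then - of_real (A $ i $ j)
        else if j \<in> cols_within A I then 0 else of_real (A $ i $ j) * of_nat (z j)
      else 0)"

fun shift_v :: "('n \<Rightarrow> nat) \<Rightarrow> 'n \<times> 'r \<times> bool \<Rightarrow> ('n \<Rightarrow> nat)" where
  "shift_v v (i, j, b) = v(i := Suc (v i))"

fun shift_z :: "('r \<Rightarrow> nat) \<Rightarrow> 'n \<times> 'r \<times> bool \<Rightarrow> ('r \<Rightarrow> nat)" where
  "shift_z z (i, j, b) = (if b then z else z(j := Suc (z j)))"

fun shift_k :: "('r \<Rightarrow> nat) \<Rightarrow> 'n \<times> 'r \<times> bool \<Rightarrow> ('r \<Rightarrow> nat)" where
  "shift_k k (i, j, b) = (if b then k(j := Suc (k j)) else k)"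

lemma sum_UNIV_triple:
  fixes f :: "'a::finite \<times> 'b::finite \<times> bool \<Rightarrow> 'c::comm_monoid_add"
  shows "(\<Sum>q\<in>UNIV. f q) = (\<Sum>i\<in>UNIV. \<Sum>j\<in>UNIV. f (i, j, True) + f (i, j, False))"
proof -
  have "(\<Sum>q\<in>UNIV. f q) = (\<Sum>i\<in>UNIV. \<Sum>j\<in>UNIV. \<Sum>b\<in>UNIV. f (i, j, b))"
    by (simp only: UNIV_Times_UNIV[symmetric] sum.cartesian_product')
  then show ?thesis by (simp add: UNIV_bool add.commute)
qed

text \<open>In the variables \<open>exp (x $ i)\<close> this direction is the Euler operator of the
  variables in \<open>I\<close>. A form supported inside \<open>I\<close> is homogeneous of degree
  1, so differentiating its inverse power returns the integrand times \<open>- z j\<close>; together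
  with the exponential this gives the weight.\<close>

lemma mellin_integrand_directional_derivative:
  fixes A :: "real ^ 'r ^ 'n" and I :: "'n set"
  assumes A: "A \<in> Sigma_nonneg"
  defines "w \<equiv> (\<chi> i. if i \<in> I then 1 else 0)"
  shows "((\<lambda>h. mellin_integrand A v z k s (x + h *\<^sub>R w)) has_vector_derivative
     ((\<Sum>i\<in>I. s $ i) + of_int (weight A I v z)) * mellin_integrand A v z k s (x + h *\<^sub>R w)
     - (\<Sum>q\<in>UNIV. shift_coeff A I z q *
          mellin_integrand A (shift_v v q) (shift_z z q) (shift_k k q) s (x + h *\<^sub>R w))) (at h)"
proof -
  \<comment> \<open>The increment becomes a complex variable \<open>c\<close>, so that the field
    derivative rules for products apply; at the end \<open>c\<close> is restricted to real
    values.\<close>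
  define \<delta> where "\<delta> = (\<lambda>i. if i \<in> I then 1 else 0 :: complex)"
  define E where "E = (\<lambda>c. exp (\<Sum>i\<in>UNIV. (s $ i + of_nat (v i)) * (of_real (x $ i) + \<delta> i * c)))"
  define L where "L = (\<lambda>j c. \<Sum>i\<in>UNIV. of_real (A $ i $ j) * exp (of_real (x $ i) + \<delta> i * c))"
  define y where "y = (\<lambda>h. x + h *\<^sub>R w)"
  have y_nth: "of_real (x $ i) + \<delta> i * of_real h = complex_of_real (y h $ i)" for i h
    by (simp add: y_def w_def \<delta>_def)
  have L_real: "L j (of_real h) = of_real (lin_form A j (y h))" for j h
    unfolding L_def y_nth lin_form_def by (simp flip: exp_of_real)
  have E_real: "E (of_real h) = exp (cpair s (y h)) * exp (of_real (\<Sum>i\<in>UNIV. real (v i) * y h $ i))" for h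
    unfolding E_def y_nth cpair_def
    by (simp add: distrib_right sum.distrib exp_add)
  have int_eq: "mellin_integrand A v z k s (y h)
      = E (of_real h) * (\<Prod>j\<in>UNIV. mellin_factor (z j) (k j) (L j (of_real h)))" for h
    by (simp add: mellin_integrand_def mellin_kernel_def E_real L_real)
  define c where "c = complex_of_real h"
  define e where "e = (\<lambda>i. exp (complex_of_real (y h $ i)))"
  define l where "l = (\<lambda>j. complex_of_real (lin_form A j (y h)))"
  define P where "P = (\<lambda>z k. \<Prod>j\<in>UNIV. mellin_factor (z j) (k j) (l j))"
  have P_zk: "(\<Prod>j\<in>UNIV. mellin_factor (z j) (k j) (l j)) = P z k" by (simp add: P_def)
  define L' where "L' = (\<lambda>j. \<Sum>i\<in>I. of_real (A $ i $ j) * e i)"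
  define S where "S = (\<Sum>i\<in>I. s $ i + of_nat (v i))"
  have l_pos: "lin_form A j (y h) > 0" for j by (rule lin_form_pos[OF A])
  have L_c: "L j c = l j" for j unfolding c_def L_real l_def ..
  have l_nz: "l j \<noteq> 0" for j using l_pos[of j] by (simp add: l_def)
  have dE: "(E has_field_derivative E c * S) (at c)"
  proof -
    have "(\<Sum>i\<in>UNIV. \<delta> i * (s $ i + of_nat (v i))) = S"
      by (simp add: S_def \<delta>_def if_distrib[of "\<lambda>t. t * _"] sum.If_cases)
    then show ?thesis unfolding E_def
      by (auto intro!: derivative_eq_intros)
  qed
  have dL: "(L j has_field_derivative L' j) (at c)" for j
  proof -
    have "(\<Sum>i\<in>UNIV. of_real (A $ i $ j) * (exp (of_real (x $ i) + \<delta> i * c) * \<delta> i)) = L' j"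
      unfolding c_def y_nth L'_def e_def
      by (simp add: \<delta>_def if_distrib[of "\<lambda>t. _ * t"] sum.If_cases)
    then show ?thesis unfolding L_def by (auto intro!: derivative_eq_intros simp: mult_ac)
  qed
  have dq: "((\<lambda>c. mellin_factor (z j) (k j) (L j c)) has_field_derivative
      (mellin_factor (z j) (Suc (k j)) (l j) - of_nat (z j) * mellin_factor (Suc (z j)) (k j) (l j)) * L' j)
      (at c)" for j
    using DERIV_chain2[OF _ dL[of j], of "mellin_factor (z j) (k j)"]
      mellin_factor_has_field_derivative[OF l_pos[of j], of "z j" "k j"]
    unfolding c_def L_real l_def by blast
  have upd: "mellin_factor (z' j) (k' j) (l j) * (\<Prod>i\<in>UNIV - {j}. mellin_factor (z i) (k i) (l i)) = P z' k'"
    if "\<And>i. i \<noteq> j \<Longrightarrow> z' i = z i" "\<And>i. i \<noteq> j \<Longrightarrow> k' i = k i" for z' k' j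
    unfolding P_def by (subst prod.remove[of UNIV j]) (auto intro!: prod.cong simp: that)
  have "((\<lambda>c. \<Prod>j\<in>UNIV. mellin_factor (z j) (k j) (L j c)) has_field_derivative
      (\<Sum>j\<in>UNIV. (mellin_factor (z j) (Suc (k j)) (l j) - of_nat (z j) * mellin_factor (Suc (z j)) (k j) (l j)) * L' j
        * (\<Prod>i\<in>UNIV - {j}. mellin_factor (z i) (k i) (L i c)))) (at c)"
    by (rule has_field_derivative_prod) (rule dq)
  moreover have "(mellin_factor (z j) (Suc (k j)) (l j) - of_nat (z j) * mellin_factor (Suc (z j)) (k j) (l j)) * L' j
        * (\<Prod>i\<in>UNIV - {j}. mellin_factor (z i) (k i) (L i c))
      = L' j * P z (k(j := Suc (k j))) - of_nat (z j) * L' j * P (z(j := Suc (z j))) k" for j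
    using upd[of j z "k(j := Suc (k j))"] upd[of j "z(j := Suc (z j))" k]
    unfolding L_c by (simp add: algebra_simps)
  ultimately have dP: "((\<lambda>c. \<Prod>j\<in>UNIV. mellin_factor (z j) (k j) (L j c)) has_field_derivative
      (\<Sum>j\<in>UNIV. L' j * P z (k(j := Suc (k j))) - of_nat (z j) * L' j * P (z(j := Suc (z j))) k)) (at c)"
    by simp

  have "((\<lambda>c. E c * (\<Prod>j\<in>UNIV. mellin_factor (z j) (k j) (L j c))) has_field_derivative
      E c * S * P z k
      + (\<Sum>j\<in>UNIV. L' j * P z (k(j := Suc (k j))) - of_nat (z j) * L' j * P (z(j := Suc (z j))) k) * E c) (at c)"
    using DERIV_mult[OF dE dP] unfolding L_c P_zk by simp
  then have deriv: "((\<lambda>h. mellin_integrand A v z k s (y h)) has_vector_derivative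
      E c * S * P z k
      + (\<Sum>j\<in>UNIV. L' j * P z (k(j := Suc (k j))) - of_nat (z j) * L' j * P (z(j := Suc (z j))) k) * E c) (at h)"
    unfolding int_eq c_def by (rule has_vector_derivative_real_field)
  have int_gen: "mellin_integrand A (v(i := Suc (v i))) z' k' s (y h) = e i * E c * P z' k'" for i z' k'
  proof -
    have "(\<Sum>i'\<in>UNIV. real ((v(i := Suc (v i))) i') * y h $ i')
        = (\<Sum>i'\<in>UNIV. real (v i') * y h $ i' + (if i' = i then y h $ i' else 0))"
      by (rule sum.cong) (auto simp: algebra_simps)
    also have "\<dots> = (\<Sum>i'\<in>UNIV. real (v i') * y h $ i') + y h $ i"
      by (simp add: sum.distrib)
    finally have "exp (complex_of_real (\<Sum>i'\<in>UNIV. real ((v(i := Suc (v i))) i') * y h $ i'))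
        = exp (of_real (\<Sum>i'\<in>UNIV. real (v i') * y h $ i')) * e i"
      by (simp only: e_def of_real_add exp_add)
    then show ?thesis
      unfolding mellin_integrand_def mellin_kernel_def c_def E_real P_def l_def
      by (simp only: mult_ac)
  qed
  \<comment> \<open>Euler's identity for a homogeneous form: its derivative \<open>L' j\<close>
    equals \<open>l j\<close> and cancels the inverse power just gained.\<close>
  have P_step: "L' j * P (z(j := Suc (z j))) k = P z k" if "j \<in> cols_within A I" for j
  proof -
    have "l j = L' j"
    proof -
      have "l j = (\<Sum>i\<in>UNIV. of_real (A $ i $ j) * e i)"
        unfolding l_def lin_form_def e_def by (simp flip: exp_of_real)
      also have "\<dots> = L' j" unfolding L'_def
        using that by (intro sum.mono_neutral_right) (auto simp: cols_within_def)
      finally show ?thesis .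
    qed
    moreover have "l j * mellin_factor (Suc (z j)) (k j) (l j) = mellin_factor (z j) (k j) (l j)"
      using l_nz[of j] by (simp add: mellin_factor_def)
    ultimately have f: "L' j * mellin_factor (Suc (z j)) (k j) (l j) = mellin_factor (z j) (k j) (l j)"
      by simp
    define R where "R = (\<Prod>i\<in>UNIV - {j}. mellin_factor (z i) (k i) (l i))"
    have u: "mellin_factor (Suc (z j)) (k j) (l j) * R = P (z(j := Suc (z j))) k"
      "mellin_factor (z j) (k j) (l j) * R = P z k"
      unfolding R_def using upd[of j "z(j := Suc (z j))" k] upd[of j z k] by simp_all
    show ?thesis unfolding u[symmetric] by (simp only: mult.assoc[symmetric] f)
  qed
  define J where "J = cols_within A I"
  define a where "a = (\<lambda>j. E c * L' j * P z (k(j := Suc (k j))))"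
  define b where "b = (\<lambda>j. E c * L' j * of_nat (z j) * P (z(j := Suc (z j))) k)"
  have "(\<Sum>q\<in>UNIV. shift_coeff A I z q *
          mellin_integrand A (shift_v v q) (shift_z z q) (shift_k k q) s (y h))
      = (\<Sum>j\<in>UNIV. \<Sum>i\<in>UNIV. (if i \<in> I then of_real (A $ i $ j) * e i else 0) *
          (- (E c * P z (k(j := Suc (k j)))) + (if j \<in> J then 0 else E c * of_nat (z j) * P (z(j := Suc (z j))) k)))"
    unfolding sum_UNIV_triple shift_v.simps int_gen
    by (subst sum.swap, intro sum.cong refl) (simp add: J_def algebra_simps)
  also have "\<dots> = (\<Sum>j\<in>UNIV. L' j *
          (- (E c * P z (k(j := Suc (k j)))) + (if j \<in> J then 0 else E c * of_nat (z j) * P (z(j := Suc (z j))) k)))"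
    by (simp add: sum_distrib_right[symmetric] sum.If_cases L'_def)
  also have "\<dots> = (\<Sum>j\<in>UNIV. (if j \<in> J then 0 else b j) - a j)"
    by (intro sum.cong refl) (simp add: a_def b_def algebra_simps)
  finally have q_sum: "(\<Sum>q\<in>UNIV. shift_coeff A I z q *
          mellin_integrand A (shift_v v q) (shift_z z q) (shift_k k q) s (y h))
      = (\<Sum>j\<in>UNIV. if j \<in> J then 0 else b j) - (\<Sum>j\<in>UNIV. a j)"
    by (simp add: sum_subtractf)
  have b_J: "b j = of_nat (z j) * (E c * P z k)" if "j \<in> J" for j
    using P_step[of j] that unfolding b_def J_def by (simp add: algebra_simps)
  have b_split: "(\<Sum>j\<in>UNIV. b j) = (\<Sum>j\<in>UNIV. if j \<in> J then 0 else b j) + (\<Sum>j\<in>J. of_nat (z j)) * (E c * P z k)"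
  proof -
    have "(\<Sum>j\<in>UNIV. b j) = (\<Sum>j\<in>UNIV. (if j \<in> J then 0 else b j) + (if j \<in> J then b j else 0))"
      by (intro sum.cong) auto
    also have "\<dots> = (\<Sum>j\<in>UNIV. if j \<in> J then 0 else b j) + (\<Sum>j\<in>J. b j)"
      by (simp add: sum.distrib sum.If_cases)
    finally show ?thesis by (simp add: b_J sum_distrib_right)
  qed
  have wt: "(\<Sum>i\<in>I. s $ i) + of_int (weight A I v z) = S - (\<Sum>j\<in>J. of_nat (z j))"
    by (simp add: weight_def S_def J_def sum.distrib)
  have "E c * S * P z k
      + (\<Sum>j\<in>UNIV. L' j * P z (k(j := Suc (k j))) - of_nat (z j) * L' j * P (z(j := Suc (z j))) k) * E c
      = S * (E c * P z k) + ((\<Sum>j\<in>UNIV. a j) - (\<Sum>j\<in>UNIV. b j))"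
    unfolding a_def b_def sum_subtractf[symmetric]
    by (simp add: sum_distrib_left algebra_simps)
  also have "\<dots> = ((\<Sum>i\<in>I. s $ i) + of_int (weight A I v z)) * mellin_integrand A v z k s (y h)
     - (\<Sum>q\<in>UNIV. shift_coeff A I z q *
          mellin_integrand A (shift_v v q) (shift_z z q) (shift_k k q) s (y h))"
    unfolding q_sum wt b_split int_eq c_def[symmetric] L_c P_zk
    by (simp add: algebra_simps)
  finally show ?thesis using deriv unfolding y_def by simp
qed

text \<open>The added factor \<open>exp (x $ i)\<close> raises the weight of every set containing
  \<open>i\<close>. A new inverse power at \<open>j\<close> lowers only sets containing the whole
  support of column \<open>j\<close>; as \<open>A $ i $ j \<noteq> 0\<close>, these contain
  \<open>i\<close>, and the two changes cancel. For \<open>I\<close> itself the coefficient vanishes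
  when \<open>j\<close> would lower the weight, so the gain is strict.\<close>

lemma weight_shift:
  fixes A :: "real ^ 'r ^ 'n"
  assumes q: "shift_coeff A I z q \<noteq> 0"
  shows "weight A I' v z \<le> weight A I' (shift_v v q) (shift_z z q)"
    and "weight A I v z < weight A I (shift_v v q) (shift_z z q)"
proof -
  obtain i j b where q_eq: "q = (i, j, b)" by (cases q)
  have i: "i \<in> I" and a: "A $ i $ j \<noteq> 0" and j: "\<not> b \<Longrightarrow> j \<notin> cols_within A I"
    using q unfolding q_eq by (auto split: if_splits)
  have sum_upd: "(\<Sum>x\<in>X. (f(y := Suc (f y))) x) = (\<Sum>x\<in>X. f x) + (if y \<in> X then 1 else 0)"
    if "finite X" for X :: "'x set" and f :: "'x \<Rightarrow> nat" and y
  proof -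
    have "(\<Sum>x\<in>X. (f(y := Suc (f y))) x) = (\<Sum>x\<in>X. f x + (if x = y then 1 else 0))"
      by (intro sum.cong) auto
    then show ?thesis using that by (simp add: sum.distrib)
  qed
  have eq: "weight A X (shift_v v q) (shift_z z q)
      = weight A X v z + (if i \<in> X then 1 else 0) - (if \<not> b \<and> j \<in> cols_within A X then 1 else 0)" for X
    unfolding q_eq weight_def shift_v.simps shift_z.simps
    by (cases b) (simp_all add: sum_upd del: fun_upd_apply)
  have "i \<in> X" if "j \<in> cols_within A X" for X using that a by (auto simp: cols_within_def)
  then show "weight A I' v z \<le> weight A I' (shift_v v q) (shift_z z q)"
    unfolding eq by auto
  show "weight A I v z < weight A I (shift_v v q) (shift_z z q)"
    unfolding eq using i j by auto
qed

lemma conv_region_mono: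
  assumes "\<And>I. weight A I v z \<le> weight A I v' z'"
  shows "conv_region A v z \<subseteq> conv_region A v' z'"
proof
  fix s assume s: "s \<in> conv_region A v z"
  show "s \<in> conv_region A v' z'"
    unfolding conv_region_def
  proof (intro CollectI allI impI)
    fix I :: "'a set" assume "I \<noteq> {}"
    then have "(\<Sum>i\<in>I. Re (s $ i)) + of_int (weight A I v z) > 0"
      using s by (simp add: conv_region_def)
    moreover have "real_of_int (weight A I v z) \<le> of_int (weight A I v' z')"
      using assms by simp
    ultimately show "(\<Sum>i\<in>I. Re (s $ i)) + of_int (weight A I v' z') > 0" by linarith
  qed
qed

text \<open>Restricting the sum to nonzero coefficients matters: for exactly these
  \<open>weight_shift\<close> guarantees that the shifted integrals still converge at
  \<open>s\<close>.\<close>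

lemma mellin_integral_by_parts:
  fixes A :: "real ^ 'r ^ 'n"
  assumes A: "A \<in> Sigma_nonneg" and s: "s \<in> conv_region A v z"
  shows "((\<Sum>i\<in>I. s $ i) + of_int (weight A I v z)) * mellin_integral A v z k s
    = (\<Sum>q | shift_coeff A I z q \<noteq> 0. shift_coeff A I z q *
         mellin_integral A (shift_v v q) (shift_z z q) (shift_k k q) s)"
proof -
  define Q where "Q = {q. shift_coeff A I z q \<noteq> 0}"
  define w :: "real ^ 'n" where "w = (\<chi> i. if i \<in> I then 1 else 0)"
  let ?c = "(\<Sum>i\<in>I. s $ i) + of_int (weight A I v z)"
  let ?F = "mellin_integrand A v z k s"
  let ?Fq = "\<lambda>q. mellin_integrand A (shift_v v q) (shift_z z q) (shift_k k q) s"
  define g where "g = (\<lambda>x. ?c * ?F x - (\<Sum>q\<in>Q. shift_coeff A I z q * ?Fq q x))"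
  have int: "integrable lborel ?F" by (rule integrable_mellin_integrand[OF A s])
  have int_q: "integrable lborel (?Fq q)" if "q \<in> Q" for q
  proof -
    have "s \<in> conv_region A (shift_v v q) (shift_z z q)"
      using conv_region_mono[OF weight_shift(1)[of A I z q]] that s unfolding Q_def by blast
    then show ?thesis by (rule integrable_mellin_integrand[OF A])
  qed
  have int_sum: "integrable lborel (\<lambda>x. \<Sum>q\<in>Q. shift_coeff A I z q * ?Fq q x)"
    by (intro Bochner_Integration.integrable_sum integrable_mult_right int_q)
  have Q_sum: "(\<Sum>q\<in>UNIV. shift_coeff A I z q * ?Fq q x) = (\<Sum>q\<in>Q. shift_coeff A I z q * ?Fq q x)" for x
    by (rule sum.mono_neutral_right) (auto simp: Q_def)
  have "(\<integral>x. g x \<partial>lborel) = 0"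
  proof (rule integral_directional_derivative_eq_0[OF int])
    show "integrable lborel g" unfolding g_def
      by (intro Bochner_Integration.integrable_diff integrable_mult_right int int_sum)
    show "continuous_on UNIV g" unfolding g_def
      by (intro continuous_on_diff continuous_on_mult continuous_on_sum continuous_on_const
          continuous_on_mellin_integrand[OF A])
    show "((\<lambda>h. ?F (x + h *\<^sub>R w)) has_vector_derivative g (x + h *\<^sub>R w)) (at h)" for x h
      using mellin_integrand_directional_derivative[OF A, of v z k s x I h]
      unfolding g_def Q_sum w_def .
  qed
  moreover have "(\<integral>x. g x \<partial>lborel)
      = ?c * mellin_integral A v z k s - (\<Sum>q\<in>Q. shift_coeff A I z q *
         mellin_integral A (shift_v v q) (shift_z z q) (shift_k k q) s)"
  proof -
    have "(\<integral>x. g x \<partial>lborel) = (\<integral>x. ?c * ?F x \<partial>lborel)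
        - (\<integral>x. (\<Sum>q\<in>Q. shift_coeff A I z q * ?Fq q x) \<partial>lborel)"
      unfolding g_def by (intro Bochner_Integration.integral_diff integrable_mult_right int int_sum)
    also have "(\<integral>x. (\<Sum>q\<in>Q. shift_coeff A I z q * ?Fq q x) \<partial>lborel)
        = (\<Sum>q\<in>Q. \<integral>x. shift_coeff A I z q * ?Fq q x \<partial>lborel)"
      by (intro Bochner_Integration.integral_sum integrable_mult_right int_q)
    finally show ?thesis by (simp only: integral_mult_right_zero mellin_integral_def)
  qed
  ultimately show ?thesis unfolding Q_def by simp
qed

text \<open>Among all index sets, only singletons and unions of column supports matter for convergence:
  for a general \<open>I\<close>, split off the union of the supports contained in it.\<close>

definition tube_sets :: "real ^ 'r ^ 'n \<Rightarrow> 'n set set" where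
  "tube_sets A = {I. I \<noteq> {} \<and>
     ((\<exists>i. I = {i}) \<or> I = (\<Union>j\<in>cols_within A I. {i. A $ i $ j \<noteq> 0}))}"

definition tube :: "real ^ 'r ^ 'n \<Rightarrow> nat \<Rightarrow> (complex ^ 'n) set" where
  "tube A M = {s. \<forall>I\<in>tube_sets A. (\<Sum>i\<in>I. Re (s $ i)) + real M > 0}"

definition linear_factors ::
  "real ^ 'r ^ 'n \<Rightarrow> ('n set \<Rightarrow> int set) \<Rightarrow> complex ^ 'n \<Rightarrow> complex" where
  "linear_factors A L s = (\<Prod>I\<in>tube_sets A. \<Prod>l\<in>L I. (\<Sum>i\<in>I. s $ i) + of_int l)"

lemma conv_regionI_tube_sets:
  fixes A :: "real ^ 'r ^ 'n"
  assumes s: "\<And>I. I \<in> tube_sets A \<Longrightarrow> (\<Sum>i\<in>I. Re (s $ i)) + of_int (weight A I v z) > 0"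
  shows "s \<in> conv_region A v z"
  unfolding conv_region_def
proof (intro CollectI allI impI)
  fix I :: "'n set" assume I: "I \<noteq> {}"
  define S where "S = (\<lambda>j. {i. A $ i $ j \<noteq> 0})"
  define U where "U = (\<Union>j\<in>cols_within A I. S j)"
  have UI: "U \<subseteq> I" unfolding U_def S_def cols_within_def by auto
  \<comment> \<open>Passing to \<open>U\<close> loses no column, so the whole negative part of the
    weight sits on \<open>U\<close>, and the coordinates in \<open>I - U\<close> contribute only the
    positive terms of \<open>single\<close>.\<close>
  have cU: "cols_within A U = cols_within A I"
    using UI unfolding U_def S_def cols_within_def by auto
  have single: "Re (s $ i) + real (v i) > 0" for i
  proof -
    have "(\<Sum>i\<in>{i}. Re (s $ i)) + of_int (weight A {i} v z) > 0"
      by (intro s) (auto simp: tube_sets_def)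
    then have "Re (s $ i) + real (v i) > (\<Sum>j\<in>cols_within A {i}. real (z j))"
      by (simp add: weight_def)
    moreover have "(\<Sum>j\<in>cols_within A {i}. real (z j)) \<ge> 0" by (rule sum_nonneg) simp
    ultimately show ?thesis by linarith
  qed
  have split: "(\<Sum>i\<in>I. f i) = (\<Sum>i\<in>U. f i) + (\<Sum>i\<in>I - U. f i)" for f :: "'n \<Rightarrow> real"
    using UI by (simp add: sum.subset_diff[of U I] add.commute)
  have "(\<Sum>i\<in>I. Re (s $ i)) + of_int (weight A I v z)
      = ((\<Sum>i\<in>U. Re (s $ i)) + of_int (weight A U v z)) + (\<Sum>i\<in>I - U. Re (s $ i) + real (v i))"
    using split[of "\<lambda>i. Re (s $ i)"] split[of "\<lambda>i. real (v i)"]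
    unfolding weight_def cU by (simp add: sum.distrib)
  also have "\<dots> > 0"
  proof (cases "U = {}")
    case True
    show ?thesis
    proof (cases "cols_within A U = {}")
      case cempty: True
      have "(\<Sum>i\<in>I - U. Re (s $ i) + real (v i)) > 0"
        using True I single by (intro sum_pos) auto
      then show ?thesis using True cempty by (simp add: weight_def)
    next
      case False
      then obtain j where j: "j \<in> cols_within A U" by blast
      obtain i where i: "i \<in> I" using I by blast
      \<comment> \<open>A zero column would be counted in the weight of every singleton.\<close>
      have sub: "cols_within A U \<subseteq> cols_within A {i}" using True by (auto simp: cols_within_def)
      have "(\<Sum>i\<in>{i}. Re (s $ i)) + of_int (weight A {i} v z) > 0"
        by (intro s) (auto simp: tube_sets_def)
      then have "Re (s $ i) + real (v i) > (\<Sum>j\<in>cols_within A {i}. real (z j))"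
        by (simp add: weight_def)
      moreover have "(\<Sum>j\<in>cols_within A U. real (z j)) \<le> (\<Sum>j\<in>cols_within A {i}. real (z j))"
        using sub by (intro sum_mono2) auto
      moreover have "(\<Sum>i\<in>I. Re (s $ i) + real (v i)) \<ge> Re (s $ i) + real (v i)"
        using i single by (intro member_le_sum) (auto intro: less_imp_le)
      ultimately show ?thesis using True by (simp add: weight_def)
    qed
  next
    case False
    then have "U \<in> tube_sets A" unfolding tube_sets_def using cU unfolding U_def S_def by auto
    moreover have "(\<Sum>i\<in>I - U. Re (s $ i) + real (v i)) \<ge> 0"
      using single by (intro sum_nonneg) (auto intro: less_imp_le)
    ultimately show ?thesis using s[of U] by linarith
  qed
  finally show "(\<Sum>i\<in>I. Re (s $ i)) + of_int (weight A I v z) > 0" .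
qed

section \<open>Clearing denominators on a tube\<close>

lemma open_tube: "open (tube A M)"
proof -
  have "tube A M = (\<Inter>I\<in>tube_sets A. {s. (\<Sum>i\<in>I. Re (s $ i)) + real M > 0})"
    by (auto simp: tube_def)
  also have "open \<dots>" by (intro open_INT ballI open_Collect_less continuous_intros) simp
  finally show ?thesis .
qed

lemma holomorphic_linear_factors: "open U \<Longrightarrow> holomorphic_Cn_on (linear_factors A L) U"
  unfolding linear_factors_def
  by (intro holomorphic_Cn_on_prod holomorphic_Cn_on_add holomorphic_Cn_on_sum
      holomorphic_Cn_on_nth holomorphic_Cn_on_const)

lemma linear_factors_split:
  fixes A :: "real ^ 'r ^ 'n"
  assumes "\<And>I. finite (L I)" "\<And>I. L' I \<subseteq> L I"
  shows "linear_factors A L s = linear_factors A L' s * linear_factors A (\<lambda>I. L I - L' I) s"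
  unfolding linear_factors_def prod.distrib[symmetric]
  by (intro prod.cong refl) (subst prod.subset_diff[OF assms(2) assms(1)], rule mult.commute)

lemma linear_factors_single:
  fixes A :: "real ^ 'r ^ 'n"
  assumes "I0 \<in> tube_sets A"
  shows "linear_factors A (\<lambda>I. if I = I0 then {l} else {}) s = (\<Sum>i\<in>I0. s $ i) + of_int l"
proof -
  have "linear_factors A (\<lambda>I. if I = I0 then {l} else {}) s
      = (\<Prod>I\<in>tube_sets A. if I = I0 then (\<Sum>i\<in>I0. s $ i) + of_int l else 1)"
    unfolding linear_factors_def by (intro prod.cong) auto
  then show ?thesis using assms by simp
qed

text \<open>Induction on the total deficit of the weights below \<open>M\<close> over
  \<open>tube_sets A\<close>. With no deficit the tube lies in the region of convergence. Otherwise
  integration by parts along a deficient set strictly reduces the deficit of each resulting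
  integral.\<close>

lemma mellin_integral_continuation:
  fixes A :: "real ^ 'r ^ 'n"
  assumes A: "A \<in> Sigma_nonneg"
  shows "\<exists>H. holomorphic_Cn_on H (tube A M) \<and> (\<forall>s\<in>conv_region A v z.
           mellin_integral A v z k s * linear_factors A (\<lambda>I. {weight A I v z..<int M}) s = H s)"
proof (induction "\<Sum>I\<in>tube_sets A. nat (int M - weight A I v z)" arbitrary: v z k rule: less_induct)
  case less
  show ?case
  proof (cases "\<forall>I\<in>tube_sets A. int M \<le> weight A I v z")
    case True
    have sub: "tube A M \<subseteq> conv_region A v z"
    proof
      fix s assume s: "s \<in> tube A M"
      show "s \<in> conv_region A v z"
      proof (rule conv_regionI_tube_sets)
        fix I assume I: "I \<in> tube_sets A"
        have "(\<Sum>i\<in>I. Re (s $ i)) + real M > 0" using s I by (simp add: tube_def)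
        moreover have "real M \<le> of_int (weight A I v z)" using True I by (metis of_int_le_iff of_int_of_nat_eq)
        ultimately show "(\<Sum>i\<in>I. Re (s $ i)) + of_int (weight A I v z) > 0" by linarith
      qed
    qed
    have "linear_factors A (\<lambda>I. {weight A I v z..<int M}) s = 1" for s
      unfolding linear_factors_def using True by (intro prod.neutral ballI) simp
    then show ?thesis
      using holomorphic_Cn_on_subset[OF holomorphic_mellin_integral[OF A] open_tube sub]
      by (intro exI[of _ "mellin_integral A v z k"]) simp
  next
    case False
    then obtain I0 where I0: "I0 \<in> tube_sets A" "weight A I0 v z < int M" by force
    define Q where "Q = {q. shift_coeff A I0 z q \<noteq> 0}"
    define L where "L = (\<lambda>I. {weight A I v z..<int M})"
    define Lq where "Lq = (\<lambda>q I. {weight A I (shift_v v q) (shift_z z q)..<int M})"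
    define L0 where "L0 = (\<lambda>I. if I = I0 then {weight A I0 v z} else {})"
    have "\<forall>q\<in>Q. \<exists>H. holomorphic_Cn_on H (tube A M) \<and>
        (\<forall>s\<in>conv_region A (shift_v v q) (shift_z z q).
           mellin_integral A (shift_v v q) (shift_z z q) (shift_k k q) s * linear_factors A (Lq q) s = H s)"
    proof
      fix q assume "q \<in> Q"
      then have q: "shift_coeff A I0 z q \<noteq> 0" by (simp add: Q_def)
      have "(\<Sum>I\<in>tube_sets A. nat (int M - weight A I (shift_v v q) (shift_z z q)))
          < (\<Sum>I\<in>tube_sets A. nat (int M - weight A I v z))"
      proof (rule sum_strict_mono_ex1)
        show "\<forall>I\<in>tube_sets A. nat (int M - weight A I (shift_v v q) (shift_z z q))
            \<le> nat (int M - weight A I v z)"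
          using weight_shift(1)[OF q] by (intro ballI nat_mono) simp
        show "\<exists>I\<in>tube_sets A. nat (int M - weight A I (shift_v v q) (shift_z z q))
            < nat (int M - weight A I v z)"
          using weight_shift(2)[OF q, of v] I0 by (intro bexI[of _ I0]) auto
      qed simp
      from less.hyps[OF this] show "\<exists>H. holomorphic_Cn_on H (tube A M) \<and>
        (\<forall>s\<in>conv_region A (shift_v v q) (shift_z z q).
           mellin_integral A (shift_v v q) (shift_z z q) (shift_k k q) s * linear_factors A (Lq q) s = H s)"
        unfolding Lq_def .
    qed
    from bchoice[OF this] obtain H where H: "\<And>q. q \<in> Q \<Longrightarrow> holomorphic_Cn_on (H q) (tube A M)"
      "\<And>q s. q \<in> Q \<Longrightarrow> s \<in> conv_region A (shift_v v q) (shift_z z q) \<Longrightarrow>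
         mellin_integral A (shift_v v q) (shift_z z q) (shift_k k q) s * linear_factors A (Lq q) s = H q s"
      by blast
    \<comment> \<open>Integration by parts consumes the lowest factor at \<open>I0\<close>. Since
      weights never fall, and rise at \<open>I0\<close>, the factors required by the shifted
      integral \<open>q\<close> are among those left; \<open>R q\<close> is the surplus.\<close>
    define R where "R = (\<lambda>q I. L I - L0 I - Lq q I)"
    define rest where "rest = linear_factors A (\<lambda>I. L I - L0 I)"
    have split: "linear_factors A L s = ((\<Sum>i\<in>I0. s $ i) + of_int (weight A I0 v z)) * rest s" for s
    proof -
      have "linear_factors A L s = linear_factors A L0 s * rest s"
        unfolding rest_def
        by (rule linear_factors_split) (use I0 in \<open>auto simp: L_def L0_def\<close>)
      then show ?thesis unfolding L0_def linear_factors_single[OF I0(1)] .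
    qed
    have rest_eq: "rest s = linear_factors A (Lq q) s * linear_factors A (R q) s"
      if "q \<in> Q" for q s
    proof -
      have q: "shift_coeff A I0 z q \<noteq> 0" using that by (simp add: Q_def)
      show ?thesis unfolding rest_def R_def
      proof (rule linear_factors_split)
        show "finite (L I - L0 I)" for I by (simp add: L_def)
        have "weight A I v z \<le> weight A I (shift_v v q) (shift_z z q)" for I
          by (rule weight_shift(1)[OF q])
        moreover have "weight A I0 v z < weight A I0 (shift_v v q) (shift_z z q)"
          by (rule weight_shift(2)[OF q])
        ultimately show "Lq q I \<subseteq> L I - L0 I" for I
          unfolding Lq_def L_def L0_def
          by (cases "I = I0") (auto intro: order_trans order_less_le_trans)
      qed
    qed
    define G where "G = (\<lambda>s. \<Sum>q\<in>Q. shift_coeff A I0 z q * (H q s * linear_factors A (R q) s))"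
    have "holomorphic_Cn_on G (tube A M)" unfolding G_def
      by (intro holomorphic_Cn_on_sum holomorphic_Cn_on_mult holomorphic_Cn_on_const H(1)
          holomorphic_linear_factors open_tube)
    moreover have "mellin_integral A v z k s * linear_factors A L s = G s"
      if s: "s \<in> conv_region A v z" for s
    proof -
      define c where "c = (\<Sum>i\<in>I0. s $ i) + of_int (weight A I0 v z)"
      define Iq where "Iq = (\<lambda>q. mellin_integral A (shift_v v q) (shift_z z q) (shift_k k q) s)"
      have parts: "c * mellin_integral A v z k s = (\<Sum>q\<in>Q. shift_coeff A I0 z q * Iq q)"
        unfolding c_def Q_def Iq_def by (rule mellin_integral_by_parts[OF A s])
      have sq: "s \<in> conv_region A (shift_v v q) (shift_z z q)" if "q \<in> Q" for q
        using conv_region_mono[OF weight_shift(1)[of A I0 z q]] that s unfolding Q_def by blast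
      have "mellin_integral A v z k s * linear_factors A L s
          = (c * mellin_integral A v z k s) * rest s" unfolding split c_def by (simp only: mult_ac)
      also have "\<dots> = (\<Sum>q\<in>Q. shift_coeff A I0 z q * Iq q * rest s)"
        unfolding parts by (rule sum_distrib_right)
      also have "\<dots> = G s" unfolding G_def
      proof (rule sum.cong[OF refl])
        fix q assume q: "q \<in> Q"
        show "shift_coeff A I0 z q * Iq q * rest s
            = shift_coeff A I0 z q * (H q s * linear_factors A (R q) s)"
          unfolding rest_eq[OF q] H(2)[OF q sq[OF q], symmetric] Iq_def by (simp only: mult_ac)
      qed
      finally show ?thesis .
    qed
    ultimately show ?thesis unfolding L_def by blast
  qed
qed

section \<open>The Mellin transform of the Shintani zeta function\<close>

text \<open>Stated with \<open>infsetsum\<close>, which is an integral against counting measure, so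
  that sum and Lebesgue integral can later be exchanged by Fubini.\<close>

lemma geometric_infsetsum_from_1:
  fixes q :: "'a :: {real_normed_field,banach,second_countable_topology}"
  assumes q: "norm q < 1"
  shows "Infinite_Set_Sum.abs_summable_on (\<lambda>m. q ^ m) {1..}" and "infsetsum (\<lambda>m. q ^ m) {1..} = q / (1 - q)"
proof -
  have bij: "bij_betw Suc UNIV {1..}"
    unfolding bij_betw_def by (auto simp: image_iff) (metis Suc_le_D)
  have s: "Infinite_Set_Sum.abs_summable_on (\<lambda>m. q ^ Suc m) UNIV"
  proof -
    have "summable (\<lambda>m. norm q * norm q ^ m)"
      using q by (intro summable_mult summable_geometric) simp
    then show ?thesis by (simp add: abs_summable_on_nat_iff' norm_mult norm_power)
  qed
  then show "Infinite_Set_Sum.abs_summable_on (\<lambda>m. q ^ m) {1..}"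
    using abs_summable_on_reindex_bij_betw[OF bij, of "\<lambda>m. q ^ m"] by simp
  have "infsetsum (\<lambda>m. q ^ m) {1..} = infsetsum (\<lambda>m. q ^ Suc m) UNIV"
    using infsetsum_reindex_bij_betw[OF bij, of "\<lambda>m. q ^ m"] by simp
  also have "\<dots> = (\<Sum>m. q * q ^ m)"
    using infsetsum_nat[OF s] by simp
  also have "\<dots> = q * (1 / (1 - q))"
    using q by (simp add: suminf_mult suminf_geometric summable_geometric)
  finally show "infsetsum (\<lambda>m. q ^ m) {1..} = q / (1 - q)" by simp
qed

lemma pos_tuples_prod:
  fixes f :: "'r::finite \<Rightarrow> nat \<Rightarrow> 'a :: {real_normed_field,banach,second_countable_topology}"
  assumes f: "\<And>j. Infinite_Set_Sum.abs_summable_on (f j) {1..}"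
  shows "Infinite_Set_Sum.abs_summable_on (\<lambda>m. \<Prod>j\<in>UNIV. f j (m $ j)) (pos_tuples :: (nat ^ 'r) set)"
    and "infsetsum (\<lambda>m. \<Prod>j\<in>UNIV. f j (m $ j)) (pos_tuples :: (nat ^ 'r) set)
           = (\<Prod>j\<in>UNIV. infsetsum (f j) {1..})"
proof -
  let ?P = "PiE UNIV (\<lambda>j::'r. {1::nat..})"
  have bij: "bij_betw vec_lambda ?P (pos_tuples :: (nat ^ 'r) set)"
  proof (rule bij_betwI[where g = vec_nth])
    show "vec_lambda \<in> ?P \<rightarrow> pos_tuples" by (auto simp: pos_tuples_def PiE_iff)
    show "vec_nth \<in> pos_tuples \<rightarrow> ?P" by (auto simp: pos_tuples_def PiE_iff)
  qed (simp_all add: vec_lambda_inverse vec_nth_inverse)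
  show "Infinite_Set_Sum.abs_summable_on (\<lambda>m. \<Prod>j\<in>UNIV. f j (m $ j)) (pos_tuples :: (nat ^ 'r) set)"
    using abs_summable_on_prod_PiE[of UNIV "\<lambda>j. {1..}" f] f
      abs_summable_on_reindex_bij_betw[OF bij, of "\<lambda>m. \<Prod>j\<in>UNIV. f j (m $ j)"]
    by simp
  show "infsetsum (\<lambda>m. \<Prod>j\<in>UNIV. f j (m $ j)) (pos_tuples :: (nat ^ 'r) set)
           = (\<Prod>j\<in>UNIV. infsetsum (f j) {1..})"
    using infsetsum_prod_PiE[of UNIV "\<lambda>j. {1..}" f] f
      infsetsum_reindex_bij_betw[OF bij, of "\<lambda>m. \<Prod>j\<in>UNIV. f j (m $ j)"]
    by simp
qed

lemma conv_region_zeta: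
  fixes A :: "real ^ 'r ^ 'n" and s :: "complex ^ 'n"
  assumes s: "\<And>i. Re (s $ i) > CARD('r)"
  shows "s \<in> conv_region A (\<lambda>i. 0) (\<lambda>j. 1)"
  unfolding conv_region_def
proof (intro CollectI allI impI)
  fix I :: "'n set" assume I: "I \<noteq> {}"
  then obtain i where i: "i \<in> I" by blast
  have pos: "Re (s $ i) > 0" for i using s[of i] of_nat_0_le_iff[of "CARD('r)"] by linarith
  have "Re (s $ i) \<le> (\<Sum>i\<in>I. Re (s $ i))"
    using i pos by (intro member_le_sum) (auto intro: less_imp_le)
  moreover have "card (cols_within A I) \<le> CARD('r)" by (intro card_mono) auto
  ultimately show "(\<Sum>i\<in>I. Re (s $ i)) + of_int (weight A I (\<lambda>i. 0) (\<lambda>j. 1)) > 0"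
    using s[of i] by (simp add: weight_def)
qed

text \<open>Both claims follow from integrability on the product of Lebesgue and counting measure.
  This is checked by summing over \<open>m\<close> first, where the series is geometric; integrating
  over \<open>x\<close> first gives Gamma factors times the terms of the zeta series, so their
  absolute summability comes for free.\<close>

lemma mellin_shintani:
  fixes A :: "real ^ 'r ^ 'n" and s :: "complex ^ 'n"
  assumes A: "A \<in> Sigma_nonneg" and s: "\<And>i. Re (s $ i) > CARD('r)"
  shows "(\<lambda>m. norm (shintani_term A s m)) summable_on pos_tuples"
    and "(\<Prod>i\<in>UNIV. Gamma (s $ i)) * shintani_zeta A s
           = mellin_integral A (\<lambda>i. 0) (\<lambda>j. 1) (\<lambda>j. 0) s"
proof -
  define C where "C = count_space (pos_tuples :: (nat ^ 'r) set)"
  have cnt: "countable (pos_tuples :: (nat ^ 'r) set)" by (rule countableI_type)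
  interpret sigma_finite_measure C
    unfolding C_def by (rule sigma_finite_measure_count_space_countable[OF cnt])
  interpret LC: pair_sigma_finite "lborel :: (real ^ 'n) measure" C ..
  have Re_pos: "Re (s $ i) > 0" for i using s[of i] of_nat_0_le_iff[of "CARD('r)"] by linarith
  define Lf where "Lf = (\<lambda>i (m :: nat ^ 'r). \<Sum>j\<in>UNIV. A $ i $ j * real (m $ j))"
  define q where "q = (\<lambda>x j. exp (- lin_form A j x))"
  define T where "T = (\<lambda>x m. exp (cpair s x) * of_real (\<Prod>j\<in>UNIV. q x j ^ (m $ j)))"
  have T_eq: "T x m = (\<Prod>i\<in>UNIV. exp (s $ i * of_real (x $ i)) * exp (- of_real (Lf i m * exp (x $ i))))" for x m
  proof -
    have "(\<Prod>j\<in>UNIV. q x j ^ (m $ j)) = exp (\<Sum>j\<in>UNIV. - (lin_form A j x * real (m $ j)))"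
      by (simp add: q_def exp_sum exp_of_nat_mult[symmetric] mult.commute)
    also have "(\<Sum>j\<in>UNIV. - (lin_form A j x * real (m $ j)))
        = (\<Sum>j\<in>UNIV. \<Sum>i\<in>UNIV. - (A $ i $ j * exp (x $ i) * real (m $ j)))"
      by (simp add: lin_form_def sum_distrib_right sum_negf)
    also have "\<dots> = (\<Sum>i\<in>UNIV. - (Lf i m * exp (x $ i)))"
      by (subst sum.swap) (simp add: Lf_def sum_distrib_right sum_distrib_left sum_negf mult_ac)
    finally have "complex_of_real (\<Prod>j\<in>UNIV. q x j ^ (m $ j))
        = (\<Prod>i\<in>UNIV. exp (- of_real (Lf i m * exp (x $ i))))"
      by (simp add: exp_sum flip: exp_of_real)
    then show ?thesis unfolding T_def cpair_def by (simp add: exp_sum prod.distrib)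
  qed
  have q01: "0 < q x j" "q x j < 1" for x j
    using lin_form_pos[OF A, of j x] by (simp_all add: q_def)
  have Lf_pos: "Lf i m > 0" if "m \<in> pos_tuples" for i m
  proof -
    obtain j where "A $ i $ j > 0" using Sigma_nonnegD(2)[OF A] by blast
    moreover have "m $ j' \<ge> 1" for j' using that by (simp add: pos_tuples_def)
    ultimately show ?thesis unfolding Lf_def
      using Sigma_nonnegD(1)[OF A]
      by (intro sum_pos2[of _ j]) (auto simp: Suc_le_eq)
  qed
  \<comment> \<open>Summing the geometric series in each \<open>m\<^sub>j\<close> gives the kernel of the Mellin integral.\<close>
  have todd0: "mellin_factor 1 0 (of_real l) = of_real (exp (- l) / (1 - exp (- l)))" if "l > 0" for l :: real
  proof -
    have "exp l \<noteq> 1" "exp (complex_of_real l) - 1 = of_real (exp l - 1)"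
      using that by (simp_all flip: exp_of_real)
    then have "mellin_factor 1 0 (of_real l) = of_real (1 / (exp l - 1))"
      using that by (simp add: mellin_factor_def todd_deriv_def todd_def field_simps)
    also have "1 / (exp l - 1) = exp (- l) / (1 - exp (- l))"
      using \<open>exp l \<noteq> 1\<close> by (simp add: exp_minus field_simps)
    finally show ?thesis .
  qed
  have kern: "mellin_integrand A (\<lambda>i. 0) (\<lambda>j. 1) (\<lambda>j. 0) s x
      = exp (cpair s x) * of_real (\<Prod>j\<in>UNIV. q x j / (1 - q x j))" for x
    unfolding mellin_integrand_def mellin_kernel_def q_def
    by (simp add: todd0[OF lin_form_pos[OF A], simplified])
  have qsum: "Infinite_Set_Sum.abs_summable_on (\<lambda>m. q x j ^ m) {1..}" "infsetsum (\<lambda>m. q x j ^ m) {1..} = q x j / (1 - q x j)" for x j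
    using geometric_infsetsum_from_1[of "q x j"] q01[of x j] by simp_all
  have psum: "Infinite_Set_Sum.abs_summable_on (\<lambda>m. \<Prod>j\<in>UNIV. q x j ^ (m $ j)) (pos_tuples :: (nat ^ 'r) set)"
    "infsetsum (\<lambda>m. \<Prod>j\<in>UNIV. q x j ^ (m $ j)) (pos_tuples :: (nat ^ 'r) set) = (\<Prod>j\<in>UNIV. q x j / (1 - q x j))" for x
    using pos_tuples_prod[of "\<lambda>j m. q x j ^ m"] qsum by simp_all
  have T_int: "integrable C (T x)" for x
    unfolding T_def C_def using psum(1)[of x]
    by (intro integrable_mult_right integrable_of_real) (simp add: abs_summable_on_def)
  have T_integral: "(\<integral>m. T x m \<partial>C) = mellin_integrand A (\<lambda>i. 0) (\<lambda>j. 1) (\<lambda>j. 0) s x" for x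
    unfolding T_def C_def kern psum(2)[of x, symmetric] infsetsum_def
    by (simp only: integral_mult_right_zero integral_complex_of_real)
  \<comment> \<open>For fixed \<open>x\<close> all terms share the phase of
    \<open>exp (cpair s x)\<close>, so the norms sum exactly to the norm of the sum.\<close>
  have T_norm: "(\<integral>m. norm (T x m) \<partial>C) = norm (mellin_integrand A (\<lambda>i. 0) (\<lambda>j. 1) (\<lambda>j. 0) s x)" for x
  proof -
    have "norm (T x m) = norm (exp (cpair s x)) * (\<Prod>j\<in>UNIV. q x j ^ (m $ j))" for m
      using q01[of x] unfolding T_def norm_mult norm_of_real
      by (simp add: abs_of_nonneg prod_nonneg less_imp_le)
    then have "(\<integral>m. norm (T x m) \<partial>C) = norm (exp (cpair s x)) * (\<Prod>j\<in>UNIV. q x j / (1 - q x j))"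
      unfolding C_def psum(2)[of x, symmetric] infsetsum_def by (simp only: integral_mult_right_zero)
    also have "\<dots> = norm (mellin_integrand A (\<lambda>i. 0) (\<lambda>j. 1) (\<lambda>j. 0) s x)"
      using q01[of x] unfolding kern norm_mult norm_of_real
      by (simp add: abs_of_nonneg prod_nonneg less_imp_le)
    finally show ?thesis .
  qed
  have F_int: "integrable lborel (mellin_integrand A (\<lambda>i. 0) (\<lambda>j. 1) (\<lambda>j. 0) s)"
    by (rule integrable_mellin_integrand[OF A conv_region_zeta[OF s]])
  have T_meas: "(\<lambda>x. T x m) \<in> borel_measurable borel" for m
    unfolding T_eq by (intro borel_measurable_continuous_onI continuous_intros)
  have T_meas2: "case_prod T \<in> borel_measurable (lborel \<Otimes>\<^sub>M C)"
  proof -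
    have "(\<lambda>(m, x). T x m) \<in> borel_measurable (C \<Otimes>\<^sub>M lborel)"
      unfolding C_def by (rule measurable_pair_measure_countable1[OF cnt]) (simp add: T_meas)
    from measurable_pair_swap[OF this] show ?thesis by (simp add: case_prod_beta')
  qed
  have T_int2: "integrable (lborel \<Otimes>\<^sub>M C) (case_prod T)"
  proof (rule LC.Fubini_integrable[OF T_meas2])
    show "integrable lborel (\<lambda>x. \<integral>m. norm (case_prod T (x, m)) \<partial>C)"
      using F_int by (simp add: T_norm)
    show "AE x in lborel. integrable C (\<lambda>m. case_prod T (x, m))"
      using T_int by (intro AE_I2) simp
  qed
  define G where "G = (\<Prod>i\<in>UNIV. Gamma (s $ i))"
  have G_nz: "G \<noteq> 0"
  proof -
    have "Gamma (s $ i) \<noteq> 0" for i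
      using Re_pos[of i] by (auto simp: Gamma_eq_zero_iff nonpos_Ints_def)
    then show ?thesis by (simp add: G_def)
  qed
  have inner: "(\<integral>x. T x m \<partial>lborel) = G * shintani_term A s m" if "m \<in> pos_tuples" for m
  proof -
    have "(\<integral>x. T x m \<partial>lborel) = (\<Prod>i\<in>UNIV. Gamma (s $ i) * complex_of_real (Lf i m) powr (- (s $ i)))"
      unfolding T_eq using Gamma_integral_exp[OF Re_pos Lf_pos[OF that]]
      by (subst lborel_integral_prod_vec(2)) simp_all
    then show ?thesis by (simp add: prod.distrib G_def shintani_term_def Lf_def)
  qed
  have "integrable C (\<lambda>m. \<integral>x. T x m \<partial>lborel)"
    by (rule LC.integrable_snd[OF T_int2])
  then have int_G: "integrable C (\<lambda>m. G * shintani_term A s m)"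
    unfolding C_def by (subst (asm) Bochner_Integration.integrable_cong[OF refl, of _ _ "\<lambda>m. G * shintani_term A s m"])
      (simp_all add: inner)
  then have abs: "Infinite_Set_Sum.abs_summable_on (\<lambda>m. shintani_term A s m) pos_tuples"
    using integrable_mult_right[OF int_G, of "inverse G"] G_nz
    unfolding abs_summable_on_def C_def by (simp add: mult.assoc[symmetric])
  then show "(\<lambda>m. norm (shintani_term A s m)) summable_on pos_tuples"
    using abs_summable_equivalent by blast
  have "mellin_integral A (\<lambda>i. 0) (\<lambda>j. 1) (\<lambda>j. 0) s = (\<integral>x. (\<integral>m. T x m \<partial>C) \<partial>lborel)"
    unfolding mellin_integral_def T_integral ..
  also have "\<dots> = (\<integral>m. (\<integral>x. T x m \<partial>lborel) \<partial>C)"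
    by (rule LC.Fubini_integral[OF T_int2, symmetric])
  also have "\<dots> = (\<integral>m. G * shintani_term A s m \<partial>C)"
    unfolding C_def by (rule Bochner_Integration.integral_cong[OF refl]) (simp add: inner)
  also have "\<dots> = G * infsetsum (shintani_term A s) pos_tuples"
    by (simp only: integral_mult_right_zero infsetsum_def C_def)
  also have "infsetsum (shintani_term A s) pos_tuples = shintani_zeta A s"
    unfolding shintani_zeta_def by (rule infsetsum_infsum[OF abs])
  finally show "(\<Prod>i\<in>UNIV. Gamma (s $ i)) * shintani_zeta A s
           = mellin_integral A (\<lambda>i. 0) (\<lambda>j. 1) (\<lambda>j. 0) s"
    by (simp add: G_def)
qed

section \<open>The meromorphic extension and its singularities\<close>

text \<open>The lower end is the weight at \<open>v = 0\<close>, \<open>z = 1\<close>, the exponents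
  of the integral that represents zeta. The cut at 0 for one-element sets leaves out exactly a
  Pochhammer product.\<close>

definition zeta_levels :: "real ^ 'r ^ 'n \<Rightarrow> nat \<Rightarrow> 'n set \<Rightarrow> int set" where
  "zeta_levels A M I =
     {- int (card (cols_within A I))..<(if card I = 1 then 0 else int M)}"

lemma zeta_times_linear_factors:
  fixes A :: "real ^ 'r ^ 'n"
  assumes A: "A \<in> Sigma_nonneg"
  shows "\<exists>N. holomorphic_Cn_on N (tube A M) \<and> (\<forall>s. (\<forall>i. Re (s $ i) > CARD('r)) \<longrightarrow>
           shintani_zeta A s * linear_factors A (zeta_levels A M) s = N s)"
proof -
  define W where "W = (\<lambda>I. {weight A I (\<lambda>i. 0) (\<lambda>j. 1)..<int M})"
  define Lv where "Lv = zeta_levels A M"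
  obtain H where H: "holomorphic_Cn_on H (tube A M)"
    "\<And>s. s \<in> conv_region A (\<lambda>i. 0) (\<lambda>j. 1) \<Longrightarrow>
       mellin_integral A (\<lambda>i. 0) (\<lambda>j. 1) (\<lambda>j. 0) s * linear_factors A W s = H s"
    using mellin_integral_continuation[OF A, of M "\<lambda>i. 0" "\<lambda>j. 1" "\<lambda>j. 0"] unfolding W_def by blast
  \<comment> \<open>\<open>rGamma (s $ i)\<close> is
    \<open>pochhammer (s $ i) M * rGamma (s $ i + of_nat M)\<close>. Keeping only the second factor
    divides out the Pochhammer zeros while \<open>N\<close> stays holomorphic.\<close>
  define N where "N = (\<lambda>s. (\<Prod>i\<in>UNIV. rGamma (s $ i + of_nat M)) * H s)"
  have "holomorphic_Cn_on N (tube A M)" unfolding N_def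
  proof (intro holomorphic_Cn_on_mult holomorphic_Cn_on_prod H open_tube)
    fix i
    show "holomorphic_Cn_on (\<lambda>s. rGamma (s $ i + of_nat M)) (tube A M)"
      by (rule holomorphic_Cn_on_compose[OF _ holomorphic_rGamma open_UNIV])
        (auto intro!: holomorphic_Cn_on_add holomorphic_Cn_on_nth holomorphic_Cn_on_const open_tube)
  qed
  moreover have "shintani_zeta A s * linear_factors A Lv s = N s"
    if s: "\<And>i. Re (s $ i) > CARD('r)" for s :: "complex ^ 'n"
  proof -
    \<comment> \<open>The factors \<open>s\<^sub>i + l\<close> with \<open>l \<ge> 0\<close> are absorbed by the zeros of the reciprocal Gamma factors.\<close>
    have W_eq: "W I = {- int (card (cols_within A I))..<int M}" for I
      by (simp add: W_def weight_def)
    have sub: "Lv I \<subseteq> W I" for I unfolding Lv_def zeta_levels_def W_eq by auto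
    have diff: "W I - Lv I = (if card I = 1 then {0..<int M} else {})" for I
      unfolding Lv_def zeta_levels_def W_eq by auto
    have single: "(\<Prod>l = 0..<int M. c + of_int l) = pochhammer c M" for c :: complex
    proof -
      have "(\<Prod>l = 0..<int M. c + of_int l) = (\<Prod>k<M. c + of_nat k)"
        by (rule prod.reindex_bij_witness[of _ int nat]) auto
      then show ?thesis by (simp add: pochhammer_prod lessThan_atLeast0)
    qed
    have "linear_factors A (\<lambda>I. W I - Lv I) s
        = (\<Prod>I\<in>tube_sets A. if card I = 1 then pochhammer (\<Sum>i\<in>I. s $ i) M else 1)"
      unfolding linear_factors_def diff by (intro prod.cong refl) (simp add: single)
    also have "\<dots> = (\<Prod>I\<in>{I\<in>tube_sets A. card I = 1}. pochhammer (\<Sum>i\<in>I. s $ i) M)"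
      by (simp add: prod.inter_filter)
    also have "\<dots> = (\<Prod>i\<in>UNIV. pochhammer (s $ i) M)"
    proof (rule prod.reindex_bij_witness[of _ "\<lambda>i. {i}" the_elem])
      fix I assume "I \<in> {I \<in> tube_sets A. card I = 1}"
      then obtain i where "I = {i}" by (auto simp: card_1_singleton_iff)
      then show "{the_elem I} = I" "pochhammer (s $ the_elem I) M = pochhammer (\<Sum>i\<in>I. s $ i) M"
        by simp_all
    qed (auto simp: tube_sets_def)
    finally have split: "linear_factors A W s = linear_factors A Lv s * (\<Prod>i\<in>UNIV. pochhammer (s $ i) M)"
      using linear_factors_split[of W Lv A s] sub by (simp add: W_def)
    have G: "rGamma (s $ i + of_nat M) * (pochhammer (s $ i) M * Gamma (s $ i)) = 1" for i
    proof -
      have pos: "Re (s $ i) > 0" using s[of i] of_nat_0_le_iff[of "CARD('r)"] by linarith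
      then have "s $ i \<notin> \<int>\<^sub>\<le>\<^sub>0" by (auto simp: nonpos_Ints_def)
      then have "rGamma (s $ i) * Gamma (s $ i) = 1"
        by (simp add: Gamma_eq_zero_iff rGamma_inverse_Gamma)
      then show ?thesis using pochhammer_rGamma[of "s $ i" M] by (simp add: mult_ac)
    qed
    have "H s = mellin_integral A (\<lambda>i. 0) (\<lambda>j. 1) (\<lambda>j. 0) s * linear_factors A W s"
      using H(2)[OF conv_region_zeta[OF s]] by simp
    also have "\<dots> = ((\<Prod>i\<in>UNIV. Gamma (s $ i)) * shintani_zeta A s) *
        (linear_factors A Lv s * (\<Prod>i\<in>UNIV. pochhammer (s $ i) M))"
      unfolding mellin_shintani(2)[OF A s] split ..
    finally have "N s = (\<Prod>i\<in>UNIV. rGamma (s $ i + of_nat M) * (pochhammer (s $ i) M * Gamma (s $ i))) *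
        (shintani_zeta A s * linear_factors A Lv s)"
      unfolding N_def prod.distrib by (simp only: mult_ac)
    then show ?thesis by (simp add: G)
  qed
  ultimately show ?thesis unfolding Lv_def by blast
qed

section \<open>Exhaustion of the space by convex tubes\<close>

lemma linear_factors_eq_0_iff:
  fixes A :: "real ^ 'r ^ 'n"
  assumes "\<And>I. finite (L I)"
  shows "linear_factors A L s = 0 \<longleftrightarrow> (\<exists>I\<in>tube_sets A. \<exists>l\<in>L I. (\<Sum>i\<in>I. s $ i) + of_int l = 0)"
  using assms unfolding linear_factors_def by simp

lemma finite_zeta_levels: "finite (zeta_levels A M I)"
  by (simp add: zeta_levels_def)

lemma zeta_levels_mono: "M \<le> M' \<Longrightarrow> zeta_levels A M I \<subseteq> zeta_levels A M' I"
  by (auto simp: zeta_levels_def)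

lemma convex_tube: "convex (tube A M)"
proof -
  have "tube A M = (\<Inter>I\<in>tube_sets A. {s. (\<Sum>i\<in>I. Re (s $ i)) + real M > 0})"
    by (auto simp: tube_def)
  also have "convex \<dots>"
  proof (intro convex_INT ballI)
    fix I :: "'a set"
    show "convex {s :: complex ^ 'a. (\<Sum>i\<in>I. Re (s $ i)) + real M > 0}"
    proof (rule convexI)
      fix x y :: "complex ^ 'a" and u v :: real
      assume xy: "x \<in> {s. (\<Sum>i\<in>I. Re (s $ i)) + real M > 0}" "y \<in> {s. (\<Sum>i\<in>I. Re (s $ i)) + real M > 0}"
        and uv: "0 \<le> u" "0 \<le> v" "u + v = 1"
      define X where "X = (\<Sum>i\<in>I. Re (x $ i)) + real M"
      define Y where "Y = (\<Sum>i\<in>I. Re (y $ i)) + real M"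
      have "(\<Sum>i\<in>I. Re ((u *\<^sub>R x + v *\<^sub>R y) $ i)) + (u + v) * real M = u * X + v * Y"
        by (simp add: X_def Y_def sum.distrib sum_distrib_left algebra_simps)
      moreover have "u * X + v * Y > 0"
      proof (cases "u = 0")
        case True
        then show ?thesis using uv xy by (simp add: Y_def)
      next
        case False
        then have "u * X > 0" using uv xy by (simp add: X_def)
        moreover have "v * Y \<ge> 0" using uv xy by (simp add: Y_def)
        ultimately show ?thesis by linarith
      qed
      ultimately show "u *\<^sub>R x + v *\<^sub>R y \<in> {s. (\<Sum>i\<in>I. Re (s $ i)) + real M > 0}"
        using uv by simp
    qed
  qed
  finally show ?thesis .
qed

lemma tube_exhausts: "\<exists>M. s \<in> tube A M"
proof -
  have "\<forall>I. \<exists>M. - (\<Sum>i\<in>I. Re (s $ i)) < real M" using reals_Archimedean2 by blast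
  then obtain m where m: "\<And>I. - (\<Sum>i\<in>I. Re (s $ i)) < real (m I)" by metis
  have "s \<in> tube A (Max (range m))"
    unfolding tube_def
  proof (intro CollectI ballI)
    fix I
    have "real (m I) \<le> real (Max (range m))" by simp
    then show "(\<Sum>i\<in>I. Re (s $ i)) + real (Max (range m)) > 0" using m[of I] by linarith
  qed
  then show ?thesis by blast
qed

lemma tube_mono: "M \<le> M' \<Longrightarrow> tube A M \<subseteq> tube A M'"
  unfolding tube_def by (fastforce intro: less_le_trans)

lemma half_space_subset_tube:
  fixes s :: "complex ^ 'n"
  assumes "\<sigma> \<ge> 0" "\<And>i. Re (s $ i) > \<sigma>"
  shows "s \<in> tube A M"
  unfolding tube_def
proof (intro CollectI ballI)
  fix I assume "I \<in> tube_sets A"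
  then have "I \<noteq> {}" by (simp add: tube_sets_def)
  then have "(\<Sum>i\<in>I. Re (s $ i)) > 0"
  proof (intro sum_pos)
    show "Re (s $ i) > 0" for i using assms(1) assms(2)[of i] by linarith
  qed simp_all
  then show "(\<Sum>i\<in>I. Re (s $ i)) + real M > 0" by simp
qed

lemma linear_factors_nonzero_half_space:
  fixes A :: "real ^ 'r ^ 'n" and s :: "complex ^ 'n"
  assumes s: "\<And>i. Re (s $ i) > CARD('r)"
  shows "linear_factors A (zeta_levels A M) s \<noteq> 0"
proof
  assume "linear_factors A (zeta_levels A M) s = 0"
  then obtain I l where I: "I \<in> tube_sets A" and l: "l \<in> zeta_levels A M I"
      and eq: "(\<Sum>i\<in>I. s $ i) + of_int l = 0"
    using linear_factors_eq_0_iff[of "zeta_levels A M" A s] finite_zeta_levels by blast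
  have "(\<Sum>i\<in>I. Re (s $ i)) + of_int l = 0" using arg_cong[OF eq, of Re] by simp
  moreover have "- real CARD('r) \<le> of_int l"
  proof -
    have "card (cols_within A I) \<le> CARD('r)" by (intro card_mono) auto
    then have "- int CARD('r) \<le> l" using l by (simp add: zeta_levels_def)
    then show ?thesis by linarith
  qed
  moreover have "(\<Sum>i\<in>I. Re (s $ i)) > CARD('r)"
  proof -
    obtain i where i: "i \<in> I" using I by (auto simp: tube_sets_def)
    have "Re (s $ i) > 0" for i using s[of i] of_nat_0_le_iff[of "CARD('r)"] by linarith
    then have "Re (s $ i) \<le> (\<Sum>i\<in>I. Re (s $ i))"
      using i by (intro member_le_sum) (auto intro: less_imp_le)
    then show ?thesis using s[of i] by linarith
  qed
  ultimately show False by linarith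
qed

lemma open_half_space: "open {s :: complex ^ 'n. \<forall>i. Re (s $ i) > \<sigma>}"
proof -
  have "{s :: complex ^ 'n. \<forall>i. Re (s $ i) > \<sigma>} = (\<Inter>i. {s. Re (s $ i) > \<sigma>})" by auto
  also have "open \<dots>" by (intro open_INT ballI open_Collect_less continuous_intros) simp
  finally show ?thesis .
qed

lemma half_space_nonempty: "{s :: complex ^ 'n. \<forall>i. Re (s $ i) > \<sigma>} \<noteq> {}"
proof -
  have "(\<chi> i. of_real (\<sigma> + 1)) \<in> {s :: complex ^ 'n. \<forall>i. Re (s $ i) > \<sigma>}" by simp
  then show ?thesis by blast
qed

text \<open>The quotients \<open>N M / D M\<close> on the growing tubes are glued. Cross-multiplied,
  two of them agree on the half space of convergence and hence, by the identity principle, on the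
  smaller tube.\<close>

lemma shintani_meromorphic_extension_exists:
  fixes A :: "real ^ 'r ^ 'n"
  assumes A: "A \<in> Sigma_nonneg"
  shows "\<exists>F. shintani_meromorphic_extension A F"
proof -
  define D where "D = (\<lambda>M. linear_factors A (zeta_levels A M))"
  define R where "R = {s :: complex ^ 'n. \<forall>i. Re (s $ i) > CARD('r)}"
  obtain N where N: "\<And>M. holomorphic_Cn_on (N M) (tube A M)"
    "\<And>M s. s \<in> R \<Longrightarrow> shintani_zeta A s * D M s = N M s"
    using zeta_times_linear_factors[OF A] unfolding D_def R_def mem_Collect_eq by metis
  have D_hol: "holomorphic_Cn_on (D M) (tube A M)" for M
    unfolding D_def by (rule holomorphic_linear_factors[OF open_tube])
  have R_sub: "R \<subseteq> tube A M" for M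
  proof
    fix s assume "s \<in> R"
    then show "s \<in> tube A M"
      by (intro half_space_subset_tube[of "real CARD('r)"]) (simp_all add: R_def)
  qed
  have D_R: "D M s \<noteq> 0" if "s \<in> R" for M s
    using that linear_factors_nonzero_half_space unfolding D_def R_def by blast
  have R: "open R" "R \<noteq> {}" unfolding R_def by (rule open_half_space half_space_nonempty)+
  \<comment> \<open>A larger \<open>M\<close> has more levels and so more zeros. A denominator
    nonzero at \<open>s\<close> for some admissible \<open>M\<close> is therefore nonzero for the
    least one, which is used in \<open>F\<close>.\<close>
  have D_mono: "D M s = 0 \<Longrightarrow> D M' s = 0" if "M \<le> M'" for M M' s
    using zeta_levels_mono[OF that, of A]
    unfolding D_def linear_factors_eq_0_iff[OF finite_zeta_levels] by blast
  have N_eq: "N M s * D M' s = N M' s * D M s" if "M \<le> M'" "s \<in> tube A M" for M M' s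
  proof (rule holomorphic_Cn_eq_extend[of _ "tube A M" _ R])
    have hol: "holomorphic_Cn_on f (tube A M)" if "holomorphic_Cn_on f (tube A M')" for f
      using holomorphic_Cn_on_subset[OF that open_tube tube_mono[OF \<open>M \<le> M'\<close>]] .
    show "holomorphic_Cn_on (\<lambda>s. N M s * D M' s) (tube A M)"
      "holomorphic_Cn_on (\<lambda>s. N M' s * D M s) (tube A M)"
      by (intro holomorphic_Cn_on_mult N(1) D_hol hol)+
    show "connected (tube A M)" by (rule convex_connected[OF convex_tube])
    show "N M s * D M' s = N M' s * D M s" if "s \<in> R" for s
      unfolding N(2)[OF that, symmetric] by (simp only: mult_ac)
  qed (use R R_sub that in auto)
  \<comment> \<open>At zeros of the denominator the quotient takes the default value 0, which is
    harmless because values on thin sets are irrelevant.\<close>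
  define F where "F = (\<lambda>s. let M = (LEAST M. s \<in> tube A M) in N M s / D M s)"
  have F_eq: "F s = N M s / D M s" if "s \<in> tube A M" "D M s \<noteq> 0" for M s
  proof -
    define M0 where "M0 = (LEAST M. s \<in> tube A M)"
    have le: "M0 \<le> M" and M0: "s \<in> tube A M0"
      unfolding M0_def using that(1) by (auto intro: Least_le LeastI)
    have "D M0 s \<noteq> 0" using D_mono[OF le] that(2) by blast
    then have "N M0 s / D M0 s = N M s / D M s"
      using N_eq[OF le M0] that(2) by (simp add: field_simps)
    then show ?thesis by (simp add: F_def M0_def)
  qed
  have "meromorphic_Cn F"
    unfolding meromorphic_Cn_def
  proof
    fix p :: "complex ^ 'n"
    obtain M where M: "p \<in> tube A M" using tube_exhausts by blast
    have "\<exists>z\<in>tube A M. D M z \<noteq> 0" using R(2) R_sub D_R by blast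
    then show "\<exists>U g h. p \<in> U \<and> connected U \<and> holomorphic_Cn_on g U \<and> holomorphic_Cn_on h U \<and>
        (\<exists>z\<in>U. h z \<noteq> 0) \<and> (\<forall>z\<in>U. h z \<noteq> 0 \<longrightarrow> F z = g z / h z)"
      using M N(1) D_hol F_eq convex_connected[OF convex_tube] by blast
  qed
  moreover have "(\<lambda>m. norm (shintani_term A s m)) summable_on pos_tuples \<and> F s = shintani_zeta A s"
    if s: "\<forall>i. Re (s $ i) > real CARD('r)" for s :: "complex ^ 'n"
  proof
    show "(\<lambda>m. norm (shintani_term A s m)) summable_on pos_tuples"
      using mellin_shintani(1)[OF A] s by blast
    have sR: "s \<in> R" using s by (simp add: R_def)
    have "F s = N 0 s / D 0 s" using F_eq[of s 0] R_sub sR D_R by blast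
    also have "\<dots> = shintani_zeta A s" unfolding N(2)[OF sR, symmetric] using D_R[OF sR] by simp
    finally show "F s = shintani_zeta A s" .
  qed
  ultimately show ?thesis unfolding shintani_meromorphic_extension_def by blast
qed

text \<open>\<open>F\<close> is compared directly with \<open>N\<close> and \<open>D\<close> through
  \<open>F * D = N\<close> off a thin set. Near \<open>p\<close> the denominator has no zeros, so
  \<open>N / D\<close> is the required holomorphic function; the witness \<open>h\<close> of the
  thin set survives shrinking to a ball, where it cannot vanish identically.\<close>

lemma shintani_extension_regular:
  fixes A :: "real ^ 'r ^ 'n"
  assumes A: "A \<in> Sigma_nonneg" and F: "shintani_meromorphic_extension A F"
    and p: "p \<in> tube A M" "linear_factors A (zeta_levels A M) p \<noteq> 0"
  shows "regular_Cn_at F p"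
proof -
  define D where "D = linear_factors A (zeta_levels A M)"
  obtain N where N: "holomorphic_Cn_on N (tube A M)"
    "\<And>s. (\<forall>i. Re (s $ i) > CARD('r)) \<Longrightarrow> shintani_zeta A s * D s = N s"
    using zeta_times_linear_factors[OF A] unfolding D_def by blast
  have D: "holomorphic_Cn_on D (tube A M)"
    unfolding D_def by (rule holomorphic_linear_factors[OF open_tube])
  obtain \<sigma> where \<sigma>: "\<And>s. (\<forall>i. Re (s $ i) > \<sigma>) \<Longrightarrow> F s = shintani_zeta A s"
    and mero: "meromorphic_Cn F"
    using F unfolding shintani_meromorphic_extension_def by blast
  \<comment> \<open>\<open>F\<close> equals the series only beyond its own \<open>\<sigma>\<close>,
    and \<open>N\<close> is known beyond \<open>CARD('r)\<close>. The maximum is nonnegative, which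
    places \<open>W\<close> in the tube.\<close>
  define W where "W = {s :: complex ^ 'n. \<forall>i. Re (s $ i) > max \<sigma> (real CARD('r))}"
  have W: "open W" "W \<noteq> {}" unfolding W_def by (rule open_half_space half_space_nonempty)+
  have W_sub: "W \<subseteq> tube A M"
  proof
    fix s assume "s \<in> W"
    then show "s \<in> tube A M"
      by (intro half_space_subset_tube[of "max \<sigma> (real CARD('r))"]) (simp_all add: W_def le_max_iff_disj)
  qed
  have W_eq: "F s * D s = N s" if "s \<in> W" for s
    using that \<sigma>[of s] N(2)[of s] by (simp add: W_def)
  obtain U h where U: "p \<in> U" "connected U" "U \<subseteq> tube A M" "holomorphic_Cn_on h U"
      "\<exists>z\<in>U. h z \<noteq> 0" "\<forall>z\<in>U. h z \<noteq> 0 \<longrightarrow> F z * D z = N z"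
    using meromorphic_Cn_identity[OF mero N(1) D convex_connected[OF convex_tube] W W_sub W_eq p(1)]
    by blast
  have "open (U \<inter> D -` (- {0}))"
    using holomorphic_Cn_on_imp_continuous_on[OF D] U(3) holomorphic_Cn_on_open[OF U(4)]
    by (intro continuous_open_preimage) (auto intro: continuous_on_subset)
  then obtain e where e: "e > 0" "ball p e \<subseteq> U \<inter> D -` (- {0})"
    using U(1) p(2) openE[of "U \<inter> D -` (- {0})" p] unfolding D_def by blast
  have sub: "ball p e \<subseteq> tube A M" "ball p e \<subseteq> U" using e U(3) by auto
  have nz: "D z \<noteq> 0" if "z \<in> ball p e" for z using e that by auto
  have "holomorphic_Cn_on (\<lambda>z. N z / D z) (ball p e)"
    using holomorphic_Cn_on_subset[OF N(1) open_ball sub(1)]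
      holomorphic_Cn_on_subset[OF D open_ball sub(1)] nz
    by (rule holomorphic_Cn_on_divide)
  moreover have "holomorphic_Cn_on h (ball p e)"
    by (rule holomorphic_Cn_on_subset[OF U(4) open_ball sub(2)])
  moreover have "\<exists>z\<in>ball p e. h z \<noteq> 0"
    using holomorphic_Cn_nonzero_dense[OF U(4,2,5) open_ball _ sub(2)] e(1) by simp
  moreover have "F z = N z / D z" if "z \<in> ball p e" "h z \<noteq> 0" for z
    using U(6) sub(2) that nz[OF that(1)] by (simp add: eq_divide_eq subset_iff)
  moreover have "p \<in> ball p e" using e(1) by simp
  ultimately show ?thesis unfolding regular_Cn_at_def using connected_ball by blast
qed

lemma linear_factor_hyperplane:
  fixes A :: "real ^ 'r ^ 'n" and s :: "complex ^ 'n"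
  assumes A: "A \<in> Sigma_nonneg" and I: "I \<in> tube_sets A" and l: "l \<in> zeta_levels A M I"
    and eq: "(\<Sum>i\<in>I. s $ i) + of_int l = 0"
  shows "\<exists>J l. J \<noteq> {} \<and> s \<in> sing_hyperplane A J l \<and>
           (mu_set A J \<in> Basis \<longrightarrow> l \<in> {0..card J - 1})"
proof -
  \<comment> \<open>The choice must be all columns supported in \<open>I\<close>, since their number
    is the initial weight up to sign and hence the offset between \<open>l\<close> and the index of
    the hyperplane.\<close>
  define J where "J = cols_within A I"
  have "J \<noteq> {}" and I_eq: "I = (\<Union>j\<in>J. {i. A $ i $ j \<noteq> 0})"
  proof -
    show J: "J \<noteq> {}"
    proof
      assume J0: "J = {}"
      \<comment> \<open>With \<open>J\<close> empty, the levels of a one-element set would form the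
        empty interval from 0 to 0. Any other tube set is a union over \<open>J\<close> and would be
        empty.\<close>
      then have "card I \<noteq> 1" using l by (auto simp: zeta_levels_def J_def split: if_splits)
      then have "I = (\<Union>j\<in>J. {i. A $ i $ j \<noteq> 0})" using I by (auto simp: tube_sets_def J_def)
      then show False using J0 I by (simp add: tube_sets_def)
    qed
    show "I = (\<Union>j\<in>J. {i. A $ i $ j \<noteq> 0})"
    proof (cases "\<exists>i. I = {i}")
      case True
      then obtain i where i: "I = {i}" by blast
      obtain j where j: "j \<in> J" using J by blast
      obtain i' where "A $ i' $ j > 0" using Sigma_nonnegD(3)[OF A] by blast
      then have ne: "A $ i' $ j \<noteq> 0" by simp
      have "{i'. A $ i' $ j \<noteq> 0} \<subseteq> I" if "j \<in> J" for j using that by (simp add: J_def cols_within_def)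
      then show ?thesis using j ne unfolding i by blast
    next
      case False
      then show ?thesis using I by (simp add: tube_sets_def J_def)
    qed
  qed
  have mu: "mu_set A J = (\<chi> i. if i \<in> I then 1 else 0)"
    unfolding mu_set_def I_eq by (auto simp: Supp_def mu_col_def vec_eq_iff)
  have pair: "pairing (mu_set A J) s = (\<Sum>i\<in>I. s $ i)"
    by (simp add: pairing_def mu if_distrib[of complex_of_real] if_distrib[of "\<lambda>t. t * _"] sum.If_cases)
  define k where "k = nat (l + int (card J))"
  have k: "int k = l + int (card J)" using l by (simp add: k_def zeta_levels_def J_def)
  have "(\<Sum>i\<in>I. s $ i) = - of_int l" using eq by (simp add: eq_neg_iff_add_eq_0)
  also have "- of_int l = of_int (int (card J) - int k)" using k by simp
  finally have "(\<Sum>i\<in>I. s $ i) = of_nat (card J) - of_nat k" by simp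
  then have "s \<in> sing_hyperplane A J k" by (simp add: sing_hyperplane_def pair)
  \<comment> \<open>A canonical basis vector forces \<open>I\<close> to be a singleton, whose levels
    are all negative, so \<open>k < card J\<close>. The lowest level \<open>- card J\<close> is
    present and yields \<open>k = 0\<close>.\<close>
  moreover have "k \<in> {0..card J - 1}" if bas: "mu_set A J \<in> Basis"
  proof -
    obtain i where i: "mu_set A J = axis i 1" using bas by (auto simp: Basis_vec_def)
    have "i' \<in> I \<longleftrightarrow> i' = i" for i'
      using arg_cong[OF i, of "\<lambda>v. v $ i'"] unfolding mu axis_def by (simp split: if_splits)
    then have "I = {i}" by blast
    then have "l < 0" using l by (simp add: zeta_levels_def)
    then show ?thesis using k by simp
  qed
  ultimately show ?thesis using \<open>J \<noteq> {}\<close> by blast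
qed

theorem theorem4p8:
  fixes A :: "real ^ 'r ^ 'n"
  assumes "A \<in> Sigma_nonneg"
  shows "(\<exists>F. shintani_meromorphic_extension A F) \<and>
    (\<forall>F. shintani_meromorphic_extension A F \<longrightarrow>
      (\<forall>s \<in> singularities_Cn F. \<exists>J l. J \<noteq> {} \<and> s \<in> sing_hyperplane A J l \<and>
         (mu_set A J \<in> Basis \<longrightarrow> l \<in> {0..card J - 1})))"
proof (intro conjI allI impI ballI)
  show "\<exists>F. shintani_meromorphic_extension A F"
    by (rule shintani_meromorphic_extension_exists[OF assms])
  fix F s
  assume F: "shintani_meromorphic_extension A F" and s: "s \<in> singularities_Cn F"
  obtain M where M: "s \<in> tube A M" using tube_exhausts by blast
  \<comment> \<open>Contraposition: in this tube every point off the zeros of the finite product is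
    regular.\<close>
  have "linear_factors A (zeta_levels A M) s = 0"
    using shintani_extension_regular[OF assms F M] s unfolding singularities_Cn_def by blast
  then obtain I l where "I \<in> tube_sets A" "l \<in> zeta_levels A M I" "(\<Sum>i\<in>I. s $ i) + of_int l = 0"
    unfolding linear_factors_eq_0_iff[OF finite_zeta_levels] by blast
  then show "\<exists>J l. J \<noteq> {} \<and> s \<in> sing_hyperplane A J l \<and>
         (mu_set A J \<in> Basis \<longrightarrow> l \<in> {0..card J - 1})"
    by (rule linear_factor_hyperplane[OF assms])
qed

end
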